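(* Let $k\in\mathbb N_+$, let $\mathcal L$ be a language with $k(P)\le k$ for all $P\in\mathcal L$, let $T$ be a canonical theory over $\mathcal L$ and $\phi\in\mathrm{Hom}^+(\mathcal A[T],\mathbb R)$. Then $\phi$ satisfies $\mathrm{Independence}[k-1]$ if and only if there exist $c\in\mathbb N_+$, $p\in\Pi_c$ and an open interpretation $I:T\rightsquigarrow T_{c,k}$ such that $\phi=\psi_{k,p}^I$.
   Context: All languages are finite relational; predicates $P$ have arity $k(P)\ge1$. A canonical theory over $\mathcal L$ is a universal theory containing, for each $P\in\mathcal L$, the axiom that $P(x_1,\dots,x_{k(P)})$ fails whenever two $x_i$ coincide. $\mathcal M[T]$: isomorphism classes of finite models. $\mathrm{Hom}^+(\mathcal A[T],\mathbb R)$: functions $\phi:\mathcal M[T]\to[0,1]$, $\phi(M)=\lim_n p(M,N_n)$ for finite models $N_n$ of $T$ of strictly increasing size ($p(M,N)$ = probability a random $|M|$-subset of $V(N)$ induces a copy of $M$). Theons: for an atomless complete probability space $\Omega=(X,\mathcal A,\mu)$, $\mathcal E_V(\Omega)=X^{r(V)}$ with $r(V)$ the finite nonempty subsets of $V$, $\mathcal E_{V,\ell}(\Omega)=X^{\{A\in r(V):|A|\le\ell\}}$, $\mathcal E_m=\mathcal E_{[m]}$, $\alpha^*(x)_A=x_{\alpha(A)}$. A $T$-on is a family of measurable $\mathcal N_P\subseteq\mathcal E_{k(P)}(\Omega)$ such that for random $\theta\in\mathcal E_{\mathbb N_+}(\Omega)$ the structure $\mathbf K$ on $\mathbb N_+$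 with $R_P(\mathbf K)=\{\alpha\text{ injective}:\alpha^*(\theta)\in\mathcal N_P\}$ is a.s. a model of $T$; $\phi_{\mathcal N}(M)=\Pr[\mathbf K|_{[|M|]}\cong M]$; every $\phi$ is of this form. A peon $\mathcal N_P\subseteq\mathcal E_m(\Omega)$ is $\ell$-independent if $\mathcal N_P=\mathcal E_{m,\ell}(\Omega)\times\mathcal H$ for some $\mathcal H\subseteq X^{\{A\subseteq[m]:|A|>\ell\}}$; $\phi$ satisfies $\mathrm{Independence}[\ell]$ if it is represented by a $T$-on all of whose peons are $\ell$-independent. Open interpretation $I:T_1\rightsquigarrow T_2$: assigns to each predicate $P$ of $T_1$ a quantifier-free formula $I(P)(x_1,\dots,x_{k(P)})$ of the language of $T_2$ such that for every model $K$ of $T_2$, the structure $I(K)$ on $V(K)$ with $R_P(I(K))=\{\alpha:K\models I(P)(\alpha)\}$ is a model of $T_1$; $\psi^I(M)=\sum\{\psi(N):N\in\mathcal M_{|M|}[T_2],I(N)\cong M\}$. $c$-colored $k$-hypergraphs: $T_{c,k}$ has $k$-ary predicates $E_1,\dots,E_c$ and axioms saying that on every tuple of pairwise distinct elements exactly one $E_i$ holds, and each $E_i$ is invariant under permuting its arguments. $\Pi_c=\{p\in(0,1)^c:\sum_{i=1}^cp_i=1\}$. For $p\in\Pi_c$, the quasirandom $c$-colored $k$-hypergraphon $\psi_{k,p}\in\mathrm{Hom}^+(\mathcal A[T_{c,k}],\mathbb R)$ is the limit of colouring each $k$-set independently with colour $i$ with probability $p_i$ (labeled density of a model $= \prod_i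 p_i^{\#\{k\text{-sets of colour }i\}}$). *)

theory Defs
  imports "HOL-Probability.Probability"
begin

section \<open>Languages, structures and universal theories\<close>

record 'p language =
  preds :: "'p set"
  arity :: "'p \<Rightarrow> nat"

definition is_language :: "'p language \<Rightarrow> bool" where
  "is_language L \<longleftrightarrow> finite (preds L) \<and> (\<forall>P\<in>preds L. 1 \<le> arity L P)"

text \<open>A tuple \<open>\<alpha> : [k(P)] \<rightarrow> V\<close> is a list of length \<open>k(P)\<close>; positions are counted from 0, so
  \<open>[m]\<close> is \<open>{..<m}\<close> throughout.\<close>

record ('p, 'v) rstruct =
  verts :: "'v set"
  rel :: "'p \<Rightarrow> 'v list set"

definition is_structure :: "'p language \<Rightarrow> ('p, 'v) rstruct \<Rightarrow> bool" where
  "is_structure L K \<longleftrightarrow>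
     (\<forall>P\<in>preds L. rel K P \<subseteq> {xs. set xs \<subseteq> verts K \<and> length xs = arity L P}) \<and>
     (\<forall>P. P \<notin> preds L \<longrightarrow> rel K P = {})"

definition induced :: "('p, 'v) rstruct \<Rightarrow> 'v set \<Rightarrow> ('p, 'v) rstruct" where
  "induced K S = \<lparr>verts = S, rel = (\<lambda>P. {xs \<in> rel K P. set xs \<subseteq> S})\<rparr>"

definition isomorphic ::
    "'p language \<Rightarrow> ('p, 'v) rstruct \<Rightarrow> ('p, 'w) rstruct \<Rightarrow> bool" where
  "isomorphic L K K' \<longleftrightarrow> (\<exists>f. bij_betw f (verts K) (verts K') \<and>
     (\<forall>P\<in>preds L. \<forall>xs. set xs \<subseteq> verts K \<longrightarrow> (xs \<in> rel K P \<longleftrightarrow> map f xs \<in> rel K' P)))"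

text \<open>Quantifier-free formulas, with variables indexed by \<open>nat\<close>. There are no propositional
  constants, so every formula mentions a variable, and the universal closure of any formula
  holds vacuously in the empty structure.\<close>

datatype 'p qf =
    EqF nat nat
  | RelF 'p "nat list"
  | NegF "'p qf"
  | AndF "'p qf" "'p qf"

definition OrF :: "'p qf \<Rightarrow> 'p qf \<Rightarrow> 'p qf" where
  "OrF F G = NegF (AndF (NegF F) (NegF G))"

definition ImpF :: "'p qf \<Rightarrow> 'p qf \<Rightarrow> 'p qf" where
  "ImpF F G = OrF (NegF F) G"

definition BigOrF :: "'p qf list \<Rightarrow> 'p qf" where
  "BigOrF Fs = foldr OrF Fs (NegF (EqF 0 0))"

primrec fvars :: "'p qf \<Rightarrow> nat set" where
  "fvars (EqF i j) = {i, j}"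
| "fvars (RelF P js) = set js"
| "fvars (NegF F) = fvars F"
| "fvars (AndF F G) = fvars F \<union> fvars G"

primrec wf_qf :: "'p language \<Rightarrow> 'p qf \<Rightarrow> bool" where
  "wf_qf L (EqF i j) = True"
| "wf_qf L (RelF P js) = (P \<in> preds L \<and> length js = arity L P)"
| "wf_qf L (NegF F) = wf_qf L F"
| "wf_qf L (AndF F G) = (wf_qf L F \<and> wf_qf L G)"

primrec sat :: "('p, 'v) rstruct \<Rightarrow> (nat \<Rightarrow> 'v) \<Rightarrow> 'p qf \<Rightarrow> bool" where
  "sat K s (EqF i j) = (s i = s j)"
| "sat K s (RelF P js) = (map s js \<in> rel K P)"
| "sat K s (NegF F) = (\<not> sat K s F)"
| "sat K s (AndF F G) = (sat K s F \<and> sat K s G)"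

text \<open>A universal theory is a set of quantifier-free formulas, each standing for its
  universal closure.\<close>

definition universal_theory :: "'p language \<Rightarrow> 'p qf set \<Rightarrow> bool" where
  "universal_theory L T \<longleftrightarrow> (\<forall>F\<in>T. wf_qf L F)"

definition is_model :: "'p language \<Rightarrow> 'p qf set \<Rightarrow> ('p, 'v) rstruct \<Rightarrow> bool" where
  "is_model L T K \<longleftrightarrow> is_structure L K \<and>
     (\<forall>F\<in>T. \<forall>s. range s \<subseteq> verts K \<longrightarrow> sat K s F)"

definition coincF :: "nat \<Rightarrow> 'p qf" where
  "coincF k = BigOrF [EqF i j. j \<leftarrow> [0..<k], i \<leftarrow> [0..<j]]"

definition diag_axiom :: "'p language \<Rightarrow> 'p \<Rightarrow> 'p qf" where
  "diag_axiom L P = ImpF (coincF (arity L P)) (NegF (RelF P [0..<arity L P]))"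

definition canonical_theory :: "'p language \<Rightarrow> 'p qf set \<Rightarrow> bool" where
  "canonical_theory L T \<longleftrightarrow> universal_theory L T \<and> (\<forall>P\<in>preds L. diag_axiom L P \<in> T)"


section \<open>Isomorphism classes of finite models, densities and limit objects\<close>

text \<open>Finite models are taken with vertex sets in \<open>nat\<close>, which loses none up to isomorphism.
  An isomorphism class is the set of all finite models on subsets of \<open>nat\<close> isomorphic to a
  given one.\<close>

definition fin_models :: "'p language \<Rightarrow> 'p qf set \<Rightarrow> ('p, nat) rstruct set" where
  "fin_models L T = {K. finite (verts K) \<and> is_model L T K}"

type_synonym 'p iclass = "('p, nat) rstruct set"

definition iclasses :: "'p language \<Rightarrow> 'p qf set \<Rightarrow> 'p iclass set" where
  "iclasses L T = fin_models L T //
     {(K, K'). K \<in> fin_models L T \<and> K' \<in> fin_models L T \<and> isomorphic L K K'}"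

definition csize :: "'p iclass \<Rightarrow> nat" where
  "csize M = card (verts (SOME K. K \<in> M))"

definition density :: "'p iclass \<Rightarrow> ('p, nat) rstruct \<Rightarrow> real" where
  "density M N = real (card {S. S \<subseteq> verts N \<and> card S = csize M \<and> induced N S \<in> M})
                 / real (card (verts N) choose csize M)"

definition Hom_plus :: "'p language \<Rightarrow> 'p qf set \<Rightarrow> ('p iclass \<Rightarrow> real) set" where
  "Hom_plus L T = {\<phi> \<in> iclasses L T \<rightarrow>\<^sub>E {0..1}.
     \<exists>N. (\<forall>n. N n \<in> fin_models L T) \<and> strict_mono (\<lambda>n. card (verts (N n))) \<and>
         (\<forall>M\<in>iclasses L T. (\<lambda>n. density M (N n)) \<longlonglongrightarrow> \<phi> M)}"


section \<open>Theons\<close>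

definition atomless :: "'x measure \<Rightarrow> bool" where
  "atomless \<Omega> \<longleftrightarrow> (\<forall>A\<in>sets \<Omega>. 0 < emeasure \<Omega> A \<longrightarrow>
     (\<exists>B\<in>sets \<Omega>. B \<subseteq> A \<and> 0 < emeasure \<Omega> B \<and> emeasure \<Omega> B < emeasure \<Omega> A))"

definition atomless_complete_prob_space :: "'x measure \<Rightarrow> bool" where
  "atomless_complete_prob_space \<Omega> \<longleftrightarrow> prob_space \<Omega> \<and> complete_measure \<Omega> \<and> atomless \<Omega>"

definition fin_ne_subsets :: "'v set \<Rightarrow> 'v set set" where
  "fin_ne_subsets V = {A. A \<subseteq> V \<and> finite A \<and> A \<noteq> {}}"

text \<open>The product space over the finite nonempty subsets of \<open>V\<close> carries the completed product
  measure.\<close>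

definition E_space :: "'v set \<Rightarrow> 'x measure \<Rightarrow> ('v set \<Rightarrow> 'x) measure" where
  "E_space V \<Omega> = completion (Pi\<^sub>M (fin_ne_subsets V) (\<lambda>_. \<Omega>))"

definition pullback ::
    "'u set \<Rightarrow> ('u \<Rightarrow> 'v) \<Rightarrow> ('v set \<Rightarrow> 'x) \<Rightarrow> ('u set \<Rightarrow> 'x)" where
  "pullback U \<alpha> x = (\<lambda>A\<in>fin_ne_subsets U. x (\<alpha> ` A))"

text \<open>The vertex set \<open>\<nat>\<^sub>+\<close> of the random structure is shifted to \<open>nat\<close>, in keeping with
  \<open>[m] = {..<m}\<close>.\<close>

definition theon_struct ::
    "'p language \<Rightarrow> ('p \<Rightarrow> (nat set \<Rightarrow> 'x) set) \<Rightarrow> (nat set \<Rightarrow> 'x) \<Rightarrow> ('p, nat) rstruct" where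
  "theon_struct L N \<theta> = \<lparr>verts = UNIV,
     rel = (\<lambda>P. if P \<in> preds L
                then {xs. length xs = arity L P \<and> distinct xs \<and>
                          pullback {..<arity L P} ((!) xs) \<theta> \<in> N P}
                else {})\<rparr>"

definition is_theon ::
    "'x measure \<Rightarrow> 'p language \<Rightarrow> 'p qf set \<Rightarrow> ('p \<Rightarrow> (nat set \<Rightarrow> 'x) set) \<Rightarrow> bool" where
  "is_theon \<Omega> L T N \<longleftrightarrow>
     (\<forall>P\<in>preds L. N P \<in> sets (E_space {..<arity L P} \<Omega>)) \<and>
     (AE \<theta> in E_space UNIV \<Omega>. is_model L T (theon_struct L N \<theta>))"

definition theon_limit ::
    "'x measure \<Rightarrow> 'p language \<Rightarrow> 'p qf set \<Rightarrow> ('p \<Rightarrow> (nat set \<Rightarrow> 'x) set)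
      \<Rightarrow> 'p iclass \<Rightarrow> real" where
  "theon_limit \<Omega> L T N = (\<lambda>M\<in>iclasses L T.
     measure (E_space UNIV \<Omega>)
       {\<theta> \<in> space (E_space UNIV \<Omega>). induced (theon_struct L N \<theta>) {..<csize M} \<in> M})"

text \<open>\<open>merge\<close> is the identification of \<open>X\<^sup>I \<times> X\<^sup>J\<close> with \<open>X\<^bsup>I \<union> J\<^esup>\<close> for disjoint \<open>I\<close>, \<open>J\<close>.\<close>

definition independent_peon ::
    "'x measure \<Rightarrow> nat \<Rightarrow> nat \<Rightarrow> (nat set \<Rightarrow> 'x) set \<Rightarrow> bool" where
  "independent_peon \<Omega> m l N \<longleftrightarrow>
     (let I = {A \<in> fin_ne_subsets {..<m}. card A \<le> l};
          J = {A \<in> fin_ne_subsets {..<m}. l < card A}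
      in \<exists>H \<subseteq> (\<Pi>\<^sub>E A\<in>J. space \<Omega>). N = merge I J ` ((\<Pi>\<^sub>E A\<in>I. space \<Omega>) \<times> H))"

text \<open>The underlying space \<open>\<Omega>\<close> of the theon is existentially quantified; the type argument
  is the type in which its points live.\<close>

definition independence ::
    "'x itself \<Rightarrow> 'p language \<Rightarrow> 'p qf set \<Rightarrow> nat \<Rightarrow> ('p iclass \<Rightarrow> real) \<Rightarrow> bool" where
  "independence TYPE('x) L T l \<phi> \<longleftrightarrow>
     (\<exists>(\<Omega> :: 'x measure) N. atomless_complete_prob_space \<Omega> \<and> is_theon \<Omega> L T N \<and>
        (\<forall>P\<in>preds L. independent_peon \<Omega> (arity L P) l (N P)) \<and>
        \<phi> = theon_limit \<Omega> L T N)"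


section \<open>Open interpretations\<close>

definition interp ::
    "'p language \<Rightarrow> ('p \<Rightarrow> 'q qf) \<Rightarrow> ('q, 'v) rstruct \<Rightarrow> ('p, 'v) rstruct" where
  "interp L1 I K = \<lparr>verts = verts K,
     rel = (\<lambda>P. if P \<in> preds L1
                then {xs. set xs \<subseteq> verts K \<and> length xs = arity L1 P \<and> sat K ((!) xs) (I P)}
                else {})\<rparr>"

text \<open>The models of the target theory range over structures with vertices in \<open>nat\<close>; that this
  is no restriction is proved in \<open>open_interpretation_all_models\<close> below.\<close>

definition open_interpretation ::
    "'p language \<Rightarrow> 'p qf set \<Rightarrow> 'q language \<Rightarrow> 'q qf set \<Rightarrow> ('p \<Rightarrow> 'q qf) \<Rightarrow> bool" where
  "open_interpretation L1 T1 L2 T2 I \<longleftrightarrow>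
     (\<forall>P\<in>preds L1. wf_qf L2 (I P) \<and> fvars (I P) \<subseteq> {..<arity L1 P}) \<and>
     (\<forall>K :: ('q, nat) rstruct. is_model L2 T2 K \<longrightarrow> is_model L1 T1 (interp L1 I K))"

definition interp_limit ::
    "'p language \<Rightarrow> 'p qf set \<Rightarrow> 'q language \<Rightarrow> 'q qf set \<Rightarrow> ('p \<Rightarrow> 'q qf)
      \<Rightarrow> ('q iclass \<Rightarrow> real) \<Rightarrow> 'p iclass \<Rightarrow> real" where
  "interp_limit L1 T1 L2 T2 I \<psi> = (\<lambda>M\<in>iclasses L1 T1.
     \<Sum>N | N \<in> iclasses L2 T2 \<and> csize N = csize M \<and> (\<exists>K\<in>N. interp L1 I K \<in> M). \<psi> N)"


section \<open>Quasirandom coloured hypergraphons\<close>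

text \<open>The predicates \<open>E\<^sub>1, \<dots>, E\<^sub>c\<close> are the numbers \<open>1, \<dots>, c\<close>.\<close>

definition col_language :: "nat \<Rightarrow> nat \<Rightarrow> nat language" where
  "col_language c k = \<lparr>preds = {1..c}, arity = (\<lambda>_. k)\<rparr>"

definition col_theory :: "nat \<Rightarrow> nat \<Rightarrow> nat qf set" where
  "col_theory c k =
     {diag_axiom (col_language c k) i | i. i \<in> {1..c}} \<union>
     {ImpF (NegF (coincF k)) (BigOrF (map (\<lambda>i. RelF i [0..<k]) [1..<Suc c]))} \<union>
     {ImpF (NegF (coincF k)) (NegF (AndF (RelF i [0..<k]) (RelF j [0..<k]))) | i j.
        i \<in> {1..c} \<and> j \<in> {1..c} \<and> i \<noteq> j} \<union>
     {ImpF (RelF i [0..<k]) (RelF i (map \<pi> [0..<k])) | i \<pi>.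
        i \<in> {1..c} \<and> \<pi> permutes {..<k}}"

definition prob_simplex :: "nat \<Rightarrow> (nat \<Rightarrow> real) set" where
  "prob_simplex c = {p \<in> {1..c} \<rightarrow>\<^sub>E {0<..<1}. (\<Sum>i=1..c. p i) = 1}"

definition labeled_density :: "nat \<Rightarrow> nat \<Rightarrow> (nat \<Rightarrow> real) \<Rightarrow> (nat, nat) rstruct \<Rightarrow> real" where
  "labeled_density c k p K =
     (\<Prod>i=1..c. p i ^ card {A. A \<subseteq> verts K \<and> card A = k \<and> (\<exists>xs\<in>rel K i. set xs = A)})"

text \<open>The density of an isomorphism class of size \<open>n\<close> is the probability that the random colouring
  of the \<open>k\<close>-subsets of \<open>[n]\<close> falls in it, i.e. the sum of the labeled densities of
  its members on \<open>[n]\<close>.\<close>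

definition quasirandom_limit ::
    "nat \<Rightarrow> nat \<Rightarrow> (nat \<Rightarrow> real) \<Rightarrow> nat iclass \<Rightarrow> real" where
  "quasirandom_limit c k p = (\<lambda>M\<in>iclasses (col_language c k) (col_theory c k).
     \<Sum>K | K \<in> M \<and> verts K = {..<csize M}. labeled_density c k p K)"


section \<open>Sanity checks\<close>

lemma sat_OrF [simp]: "sat K s (OrF F G) \<longleftrightarrow> sat K s F \<or> sat K s G"
  by (simp add: OrF_def)

lemma sat_ImpF [simp]: "sat K s (ImpF F G) \<longleftrightarrow> (sat K s F \<longrightarrow> sat K s G)"
  by (simp add: ImpF_def)

lemma sat_BigOrF [simp]: "sat K s (BigOrF Fs) \<longleftrightarrow> (\<exists>F\<in>set Fs. sat K s F)"
  unfolding BigOrF_def by (induction Fs) auto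

lemma sat_coincF [simp]: "sat K s (coincF k) \<longleftrightarrow> \<not> distinct (map s [0..<k])"
proof -
  have "sat K s (coincF k) \<longleftrightarrow> (\<exists>j<k. \<exists>i<j. s i = s j)"
  proof -
    have "set [EqF i j. j \<leftarrow> [0..<k], i \<leftarrow> [0..<j]] = {EqF i j | i j. j < k \<and> i < j}"
      by auto
    then show ?thesis unfolding coincF_def sat_BigOrF by auto
  qed
  also have "\<dots> \<longleftrightarrow> \<not> distinct (map s [0..<k])"
  proof
    assume "\<exists>j<k. \<exists>i<j. s i = s j"
    then obtain i j where "j < k" "i < j" "s i = s j" by blast
    then have "i < k" "i \<noteq> j" "map s [0..<k] ! i = map s [0..<k] ! j" by auto
    then show "\<not> distinct (map s [0..<k])"
      using \<open>j < k\<close> nth_eq_iff_index_eq[of "map s [0..<k]" i j] by auto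
  next
    assume "\<not> distinct (map s [0..<k])"
    then obtain i j where "i < k" "j < k" "i \<noteq> j" "s i = s j"
      by (auto simp: distinct_conv_nth)
    then show "\<exists>j<k. \<exists>i<j. s i = s j"
      by (cases i j rule: linorder_cases) (blast, simp, metis)
  qed
  finally show ?thesis .
qed

lemma wf_OrF [simp]: "wf_qf L (OrF F G) \<longleftrightarrow> wf_qf L F \<and> wf_qf L G"
  by (simp add: OrF_def)

lemma wf_ImpF [simp]: "wf_qf L (ImpF F G) \<longleftrightarrow> wf_qf L F \<and> wf_qf L G"
  by (simp add: ImpF_def)

lemma wf_BigOrF [simp]: "wf_qf L (BigOrF Fs) \<longleftrightarrow> (\<forall>F\<in>set Fs. wf_qf L F)"
  unfolding BigOrF_def by (induction Fs) auto

lemma wf_coincF [simp]: "wf_qf L (coincF k)"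
  by (auto simp: coincF_def)

lemma canonical_col_theory: "canonical_theory (col_language c k) (col_theory c k)"
  by (auto simp: canonical_theory_def universal_theory_def col_theory_def diag_axiom_def
      col_language_def)

lemma sat_cong: "(\<And>i. i \<in> fvars F \<Longrightarrow> s i = s' i) \<Longrightarrow> sat K s F \<longleftrightarrow> sat K s' F"
proof (induction F)
  case (RelF P js)
  then have "map s js = map s' js" by simp
  then show ?case by (metis sat.simps(2))
qed auto

lemma ex_assignment:
  assumes "set xs \<subseteq> V \<and> length xs = k" "1 \<le> k"
  obtains s where "range s \<subseteq> V" "map s [0..<k] = xs"
proof
  let ?s = "\<lambda>i. if i < length xs then xs ! i else xs ! 0"
  have "?s i \<in> V" for i
  proof -
    have "xs ! (if i < length xs then i else 0) \<in> V"
      using assms by (intro subsetD[OF _ nth_mem, of xs]) auto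
    then show ?thesis by (cases "i < length xs") auto
  qed
  then show "range ?s \<subseteq> V" by blast
  show "map ?s [0..<k] = xs" using assms by (intro nth_equalityI) auto
qed

lemma is_model_col_theory_iff:
  assumes "1 \<le> k"
  shows "is_model (col_language c k) (col_theory c k) K \<longleftrightarrow>
     is_structure (col_language c k) K \<and>
     (\<forall>i\<in>{1..c}. \<forall>xs\<in>rel K i. distinct xs) \<and>
     (\<forall>xs. set xs \<subseteq> verts K \<and> length xs = k \<and> distinct xs \<longrightarrow> (\<exists>!i. i \<in> {1..c} \<and> xs \<in> rel K i)) \<and>
     (\<forall>i\<in>{1..c}. \<forall>xs\<in>rel K i. \<forall>\<pi>. \<pi> permutes {..<k} \<longrightarrow> map (\<lambda>j. xs ! \<pi> j) [0..<k] \<in> rel K i)"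
    (is "?L \<longleftrightarrow> ?S \<and> ?A \<and> ?B \<and> ?C")
proof
  assume L: ?L
  then have S: ?S by (simp add: is_model_def)
  have ax: "sat K s F" if "F \<in> col_theory c k" "range s \<subseteq> verts K" for F s
    using L that by (auto simp: is_model_def)
  have len: "set xs \<subseteq> verts K \<and> length xs = k" if "i \<in> {1..c}" "xs \<in> rel K i" for i xs
    using S that unfolding is_structure_def col_language_def by fastforce
  have A: "distinct xs" if i: "i \<in> {1..c}" and x: "xs \<in> rel K i" for i xs
  proof -
    obtain s where s: "range s \<subseteq> verts K" "map s [0..<k] = xs"
      using ex_assignment[OF len[OF i x] assms] by blast
    have "diag_axiom (col_language c k) i \<in> col_theory c k"
      using i by (auto simp: col_theory_def)
    from ax[OF this s(1)] show ?thesis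
      using s(2) x by (auto simp: diag_axiom_def col_language_def)
  qed
  have B: "\<exists>!i. i \<in> {1..c} \<and> xs \<in> rel K i" if x: "set xs \<subseteq> verts K" "length xs = k" "distinct xs" for xs
  proof -
    obtain s where s: "range s \<subseteq> verts K" "map s [0..<k] = xs"
      using ex_assignment[of xs "verts K" k] x assms by blast
    have "ImpF (NegF (coincF k)) (BigOrF (map (\<lambda>i. RelF i [0..<k]) [1..<Suc c])) \<in> col_theory c k"
      by (auto simp: col_theory_def)
    from ax[OF this s(1)] have ex: "\<exists>i\<in>{1..c}. xs \<in> rel K i"
      using s(2) x(3) by auto
    have un: "i = j" if "i \<in> {1..c}" "j \<in> {1..c}" "xs \<in> rel K i" "xs \<in> rel K j" for i j
    proof (rule ccontr)
      assume "i \<noteq> j"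
      then have "ImpF (NegF (coincF k)) (NegF (AndF (RelF i [0..<k]) (RelF j [0..<k]))) \<in> col_theory c k"
        using that unfolding col_theory_def by blast
      from ax[OF this s(1)] show False using s(2) x(3) that by auto
    qed
    from ex un show ?thesis by blast
  qed
  have C: "map (\<lambda>j. xs ! \<pi> j) [0..<k] \<in> rel K i"
    if i: "i \<in> {1..c}" and x: "xs \<in> rel K i" and p: "\<pi> permutes {..<k}" for i xs \<pi>
  proof -
    obtain s where s: "range s \<subseteq> verts K" "map s [0..<k] = xs"
      using ex_assignment[OF len[OF i x] assms] by blast
    have "ImpF (RelF i [0..<k]) (RelF i (map \<pi> [0..<k])) \<in> col_theory c k"
      using i p unfolding col_theory_def by blast
    from ax[OF this s(1)] have "map s (map \<pi> [0..<k]) \<in> rel K i" using s(2) x by simp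
    moreover have "map s (map \<pi> [0..<k]) = map (\<lambda>j. xs ! \<pi> j) [0..<k]"
      unfolding s(2)[symmetric] using permutes_in_image[OF p] by auto
    ultimately show ?thesis by metis
  qed
  show "?S \<and> ?A \<and> ?B \<and> ?C" using S A B C by blast
next
  assume R: "?S \<and> ?A \<and> ?B \<and> ?C"
  have "sat K s F" if F: "F \<in> col_theory c k" and s: "range s \<subseteq> verts K" for F s
  proof -
    let ?x = "map s [0..<k]"
    have x: "set ?x \<subseteq> verts K" "length ?x = k" using s by auto
    consider (1) i where "i \<in> {1..c}" "F = diag_axiom (col_language c k) i"
      | (2) "F = ImpF (NegF (coincF k)) (BigOrF (map (\<lambda>i. RelF i [0..<k]) [1..<Suc c]))"
      | (3) i j where "i \<in> {1..c}" "j \<in> {1..c}" "i \<noteq> j"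
          "F = ImpF (NegF (coincF k)) (NegF (AndF (RelF i [0..<k]) (RelF j [0..<k])))"
      | (4) i \<pi> where "i \<in> {1..c}" "\<pi> permutes {..<k}"
          "F = ImpF (RelF i [0..<k]) (RelF i (map \<pi> [0..<k]))"
      using F unfolding col_theory_def by blast
    then show ?thesis
    proof cases
      case 1
      then show ?thesis using R unfolding diag_axiom_def col_language_def by (auto simp del: distinct_map)
    next
      case 2
      have "distinct ?x \<Longrightarrow> \<exists>i\<in>{1..c}. ?x \<in> rel K i" using R x by blast
      then show ?thesis unfolding 2 sat_ImpF sat_BigOrF sat.simps sat_coincF set_map
        by (simp only: not_not set_upt atLeastLessThanSuc_atLeastAtMost Set.bex_simps sat.simps) blast
    next
      case 3
      have "distinct ?x \<Longrightarrow> \<not> (?x \<in> rel K i \<and> ?x \<in> rel K j)" using R x 3 by blast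
      then show ?thesis unfolding 3 by (auto simp del: distinct_map)
    next
      case 4
      have "map s (map \<pi> [0..<k]) = map (\<lambda>j. ?x ! \<pi> j) [0..<k]"
        using permutes_in_image[OF 4(2)] by auto
      then show ?thesis using R 4 by (auto simp del: map_map)
    qed
  qed
  then show ?L using R by (auto simp: is_model_def)
qed

lemma sat_embed:
  assumes "inj_on f V" "range s \<subseteq> V"
    and "\<And>P xs. set xs \<subseteq> V \<Longrightarrow> map f xs \<in> rel K' P \<longleftrightarrow> xs \<in> rel K P"
  shows "sat K' (f \<circ> s) F \<longleftrightarrow> sat K s F"
proof (induction F)
  case (EqF i j)
  have "s i \<in> V" "s j \<in> V" using assms(2) by auto
  then show ?case using assms(1) by (auto simp: inj_on_def)
next
  case (RelF P js)
  have "set (map s js) \<subseteq> V" using assms(2) by auto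
  from assms(3)[OF this, of P] show ?case by (simp add: comp_def)
qed auto

lemma open_interpretation_all_models:
  fixes K :: "('q, 'v) rstruct"
  assumes I: "open_interpretation L1 T1 L2 T2 I" and K: "is_model L2 T2 K"
  shows "is_model L1 T1 (interp L1 I K)"
  unfolding is_model_def
proof (intro conjI ballI allI impI)
  show "is_structure L1 (interp L1 I K)" by (auto simp: is_structure_def interp_def)
next
  fix F and s :: "nat \<Rightarrow> 'v" assume F: "F \<in> T1" and "range s \<subseteq> verts (interp L1 I K)"
  then have s: "range s \<subseteq> verts K" by (simp add: interp_def)
  have fin_fv: "finite (fvars G)" for G :: "'z qf" by (induction G) auto
  define W where "W = insert (s 0) (s ` fvars F)"
  have W: "finite W" "W \<subseteq> verts K" using s fin_fv by (auto simp: W_def)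
  define s' where "s' = (\<lambda>i. if i \<in> fvars F then s i else s 0)"
  have s': "range s' \<subseteq> W" by (auto simp: s'_def W_def)
  obtain f :: "'v \<Rightarrow> nat" where f: "inj_on f W"
    using finite_imp_inj_to_nat_seg[OF W(1)] by blast
  define K' where "K' = \<lparr>verts = f ` W, rel = (\<lambda>P. {map f xs | xs. xs \<in> rel K P \<and> set xs \<subseteq> W})\<rparr>"
  have relK': "map f xs \<in> rel K' P \<longleftrightarrow> xs \<in> rel K P" if "set xs \<subseteq> W" for xs P
  proof -
    have "map f xs = map f ys \<Longrightarrow> set ys \<subseteq> W \<Longrightarrow> xs = ys" for ys
      using that f by (meson inj_on_map_eq_map inj_on_subset le_sup_iff Un_least)
    then show ?thesis using that by (auto simp: K'_def)
  qed
  have satK': "sat K' (f \<circ> t) G \<longleftrightarrow> sat K t G" if "range t \<subseteq> W" for t G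
    by (rule sat_embed[OF f that relK'])
  have "is_structure L2 K'"
    using K by (fastforce simp: is_model_def is_structure_def K'_def)
  moreover have "sat K' t G" if "G \<in> T2" "range t \<subseteq> verts K'" for t G
  proof -
    define u where "u = inv_into W f \<circ> t"
    have ft: "t i \<in> f ` W" for i using that(2) by (auto simp: K'_def)
    have u: "range u \<subseteq> W" using ft by (auto simp: u_def intro: inv_into_into)
    have "f \<circ> u = t" using ft by (auto simp: u_def f_inv_into_f)
    moreover have "sat K u G" using K that(1) u W(2) by (auto simp: is_model_def)
    ultimately show ?thesis using satK'[OF u, of G] by simp
  qed
  ultimately have "is_model L2 T2 K'" by (simp add: is_model_def)
  then have M: "is_model L1 T1 (interp L1 I K')" using I by (auto simp: open_interpretation_def)
  have "range (f \<circ> s') \<subseteq> verts (interp L1 I K')"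
    using s' by (auto simp: interp_def K'_def)
  then have 1: "sat (interp L1 I K') (f \<circ> s') F" using M F by (auto simp: is_model_def)
  have rel: "map f xs \<in> rel (interp L1 I K') P \<longleftrightarrow> xs \<in> rel (interp L1 I K) P"
    if xs: "set xs \<subseteq> W" for xs P
  proof (cases "P \<in> preds L1 \<and> length xs = arity L1 P")
    case True
    then have fv: "fvars (I P) \<subseteq> {..<length xs}" using I by (auto simp: open_interpretation_def)
    define t where "t = (\<lambda>i. if i < length xs then xs ! i else s 0)"
    have t: "range t \<subseteq> W" using subsetD[OF xs nth_mem] by (auto simp: t_def W_def)
    have "sat K' ((!) (map f xs)) (I P) \<longleftrightarrow> sat K' (f \<circ> t) (I P)"
      using fv by (intro sat_cong) (auto simp: t_def)
    also have "\<dots> \<longleftrightarrow> sat K t (I P)" by (rule satK'[OF t])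
    also have "\<dots> \<longleftrightarrow> sat K ((!) xs) (I P)"
      using fv by (intro sat_cong) (auto simp: t_def)
    finally show ?thesis using True xs W(2) by (auto simp: interp_def K'_def)
  next
    case False
    then show ?thesis by (auto simp: interp_def)
  qed
  have "sat (interp L1 I K) s' F" using 1 sat_embed[OF f s' rel] by blast
  then show "sat (interp L1 I K) s F"
    using sat_cong[of F s s' "interp L1 I K"] by (simp add: s'_def)
qed

end

theory Submission
  imports Defs
begin

text \<open>
  A peon of arity \<open>k\<close> that is \<open>(k - 1)\<close>-independent is of the form \<open>{x. x [k] \<in> H}\<close>, and one of smaller
  arity is trivial. Hence in a theon with independent peons a tuple satisfies a \<open>k\<close>-ary predicate
  according to the value of \<open>\<theta>\<close> at its underlying \<open>k\<close>-set, that is, according to a random colour drawn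
  independently for each \<open>k\<close>-set from the finitely many Boolean combinations of the sets \<open>H\<close>; each
  finite colouring has positive probability, so reading the predicates off the colours is an open
  interpretation. Conversely, on a tuple of distinct vertices of a coloured \<open>k\<close>-hypergraph a formula in
  at most \<open>k\<close> variables depends on a single colour, and by Sierpinski's theorem the colours can be
  realised by a partition of \<open>\<Omega>\<close> into sets of the prescribed measures.
\<close>

section \<open>Atomless measures\<close>

text \<open>Both directions rest on one claim, \<open>theon_limit_colouring\<close>: if the
  structure of a theon is almost surely the interpretation of the colouring
  \<open>g (\<theta> A)\<close>, then the two limits agree. Null sets shape the rest. An
  interpretation must send every coloured hypergraph to a model, while a theon yields a model only
  almost surely. Hence every colour needs positive probability, Boolean combinations of measure 0
  are discarded, and the decoding of colours is correct only almost everywhere. The open simplex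
  also excludes a colour of probability 1, so a single colour is never enough.

  Independence provides \<open>H\<close> as a bare set, and peons are measurable only for the
  completed product; measurability of \<open>H\<close>, and with it of the colours, is regained from
  Fubini and the completeness of \<open>\<Omega>\<close>. In the converse direction the obstacle is
  the diagonal: a formula may hold on tuples with repeated entries, which the structure of a theon
  never contains, and the axioms of a canonical theory have to rule this out.\<close>

lemma atomless_small_subset:
  assumes M: "finite_measure M" "atomless M"
    and A: "A \<in> sets M" "0 < measure M A" and e: "0 < e"
  shows "\<exists>B\<in>sets M. B \<subseteq> A \<and> 0 < measure M B \<and> measure M B < e"
proof -
  interpret finite_measure M by fact
  \<comment> \<open>Both \<open>B\<close> and \<open>C - B\<close> have positive measure, and one of
    them has at most half the measure of \<open>C\<close>.\<close>
  have half: "\<exists>B\<in>sets M. B \<subseteq> C \<and> 0 < measure M B \<and> measure M B \<le> measure M C / 2"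
    if C: "C \<in> sets M" "0 < measure M C" for C
  proof -
    obtain B where B: "B \<in> sets M" "B \<subseteq> C" "0 < measure M B" "measure M B < measure M C"
      using M(2) C unfolding atomless_def emeasure_eq_measure by (auto simp: ennreal_less_iff)
    have "measure M (C - B) = measure M C - measure M B"
      using B C by (intro finite_measure_Diff) auto
    then show ?thesis
      using B C by (cases "measure M B \<le> measure M C / 2") (rule bexI[of _ B], simp, simp, rule bexI[of _ "C - B"], auto)
  qed
  have "\<exists>B\<in>sets M. B \<subseteq> A \<and> 0 < measure M B \<and> measure M B \<le> measure M A / 2 ^ n" for n
  proof (induction n)
    case 0
    then show ?case using A by auto
  next
    case (Suc n)
    then obtain B where "B \<in> sets M" "B \<subseteq> A" "0 < measure M B" "measure M B \<le> measure M A / 2 ^ n"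
      by blast
    with half[of B] obtain B' where "B' \<in> sets M" "B' \<subseteq> B" "0 < measure M B'" "measure M B' \<le> measure M B / 2"
      by blast
    moreover from this have "measure M B' \<le> measure M A / 2 ^ n / 2"
      using \<open>measure M B \<le> measure M A / 2 ^ n\<close> by simp
    ultimately show ?case using \<open>B \<subseteq> A\<close> by (intro bexI[of _ B']) (auto simp: mult.commute)
  qed
  moreover obtain n where "measure M A / 2 ^ n < e"
    using real_arch_pow_inv[of "e / measure M A" "1/2"] A e by (auto simp: field_simps)
  ultimately show ?thesis by (meson le_less_trans)
qed

text \<open>Sierpinski's theorem. Greedy exhaustion: each step adds a set of at least half the largest
  admissible measure, so no admissible set of positive measure is left in the limit.\<close>

theorem atomless_intermediate_measure:
  assumes M: "finite_measure M" "atomless M"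
    and A: "A \<in> sets M" and t: "0 \<le> t" "t \<le> measure M A"
  shows "\<exists>B\<in>sets M. B \<subseteq> A \<and> measure M B = t"
proof -
  interpret finite_measure M by fact
  define feas where "feas B E \<longleftrightarrow> E \<in> sets M \<and> E \<subseteq> A - B \<and> measure M E \<le> t - measure M B" for B E
  define ok where "ok B \<longleftrightarrow> B \<in> sets M \<and> B \<subseteq> A \<and> measure M B \<le> t" for B
  define R where "R B B' \<longleftrightarrow> B \<subseteq> B' \<and> (\<forall>E. feas B E \<longrightarrow> measure M E \<le> 2 * (measure M B' - measure M B))" for B B'
  have "ok {}" using t by (simp add: ok_def)
  moreover have "\<exists>B'. ok B' \<and> R B B'" if B: "ok B" for B
  proof -
    define s where "s = (SUP E\<in>Collect (feas B). measure M E)"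
    have bdd: "bdd_above (measure M ` Collect (feas B))"
      by (auto simp: feas_def bdd_above_def)
    have ne: "{} \<in> Collect (feas B)" using B by (auto simp: feas_def ok_def)
    have le: "measure M E \<le> s" if "feas B E" for E
      unfolding s_def using that by (intro cSUP_upper bdd) simp
    \<comment> \<open>The supremum need not be attained, which is why half of it is asked for: if
      \<open>s\<close> is positive, \<open>s / 2\<close> lies strictly below it, and otherwise the
      empty set serves.\<close>
    have "\<exists>E. feas B E \<and> s \<le> 2 * measure M E"
    proof (cases "s \<le> 0")
      case True
      then show ?thesis using ne measure_nonneg[of M "{}"] by (intro exI[of _ "{}"]) auto
    next
      case False
      then have "s / 2 < s" by simp
      then obtain E where "feas B E" "s / 2 < measure M E"
        unfolding s_def using less_cSUP_iff[OF _ bdd, of "s/2"] ne by (auto simp: s_def)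
      then show ?thesis by (intro exI[of _ E]) auto
    qed
    then obtain E where E: "feas B E" "s \<le> 2 * measure M E" by blast
    have "measure M (B \<union> E) = measure M B + measure M E"
      using E(1) B by (intro finite_measure_Union) (auto simp: feas_def ok_def)
    then have "ok (B \<union> E)" "R B (B \<union> E)"
      using E B le order_trans[OF le E(2)] by (auto simp: feas_def ok_def R_def)
    then show ?thesis by blast
  qed
  ultimately obtain B where B: "\<And>n. ok (B n)" "\<And>n::nat. R (B n) (B (Suc n))"
    using dependent_nat_choice[of "\<lambda>_. ok" "\<lambda>_. R"] by blast
  have inc: "incseq B" using B(2) by (intro incseq_SucI) (auto simp: R_def)
  define U where "U = (\<Union>n. B n)"
  have U: "U \<in> sets M" "U \<subseteq> A" using B(1) by (auto simp: U_def ok_def)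
  have lim: "(\<lambda>n. measure M (B n)) \<longlonglongrightarrow> measure M U"
    unfolding U_def using B(1) inc by (intro finite_Lim_measure_incseq) (auto simp: ok_def)
  have Ut: "measure M U \<le> t"
    using lim B(1) by (intro LIMSEQ_le_const2[OF lim]) (auto simp: ok_def)
  have "\<not> measure M U < t"
  proof
    assume less: "measure M U < t"
    have "measure M (A - U) = measure M A - measure M U"
      using U A by (intro finite_measure_Diff) auto
    then have "0 < measure M (A - U)" using less t by simp
    then obtain E where E: "E \<in> sets M" "E \<subseteq> A - U" "0 < measure M E" "measure M E < t - measure M U"
      using atomless_small_subset[OF M, of "A - U" "t - measure M U"] A U less by auto
    \<comment> \<open>The leftover \<open>E\<close> stays admissible at every stage, so each
      increment is at least half its measure; but the increments tend to 0 because the measures of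
      the \<open>B n\<close> converge.\<close>
    have "measure M E \<le> 2 * (measure M (B (Suc n)) - measure M (B n))" for n
    proof -
      have "B n \<subseteq> U" by (auto simp: U_def)
      moreover from this have "measure M (B n) \<le> measure M U" using U by (intro finite_measure_mono)
      ultimately have "feas (B n) E" using E by (auto simp: feas_def)
      then show ?thesis using B(2)[of n] by (auto simp: R_def)
    qed
    moreover have "(\<lambda>n. 2 * (measure M (B (Suc n)) - measure M (B n))) \<longlonglongrightarrow> 2 * (measure M U - measure M U)"
      by (intro tendsto_intros lim LIMSEQ_Suc)
    ultimately have "measure M E \<le> 2 * (measure M U - measure M U)"
      by (intro LIMSEQ_le_const) auto
    then show False using E by simp
  qed
  then show ?thesis using U Ut by (intro bexI[of _ U]) auto
qed

text \<open>Colours are carved one at a time out of a reserve of colour 0, whose measure is 1 minus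
  the probabilities already spent. After \<open>c\<close> steps the reserve is null, and
  \<open>max 1\<close> recolours it, so that \<open>g\<close> takes values in \<open>{1..c}\<close>
  everywhere and not only almost everywhere.\<close>

lemma atomless_finite_distribution:
  assumes "prob_space M" "atomless M" and p: "p \<in> prob_simplex c"
  shows "\<exists>g \<in> measurable M (count_space UNIV). (\<forall>x. g x \<in> {1..c}) \<and>
    (\<forall>i\<in>{1..c}. measure M {x \<in> space M. g x = i} = p i)"
proof -
  interpret prob_space M by fact
  have pos: "0 < p i" if "i \<in> {1..c}" for i using p that by (auto simp: prob_simplex_def Pi_iff PiE_def)
  have sum: "(\<Sum>i=1..c. p i) = 1" using p by (simp add: prob_simplex_def)
  then have c: "1 \<le> c" by (cases c) auto
  have "\<exists>g \<in> measurable M (count_space UNIV). (\<forall>x. g x \<le> n) \<and>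
      (\<forall>i\<in>{1..n}. prob {x \<in> space M. g x = i} = p i) \<and>
      prob {x \<in> space M. g x = 0} = 1 - (\<Sum>i=1..n. p i)" if "n \<le> c" for n
    using that
  proof (induction n)
    case 0
    then show ?case by (intro bexI[of _ "\<lambda>_. 0"]) (auto simp: prob_space)
  next
    case (Suc n)
    then obtain g where g[measurable]: "g \<in> measurable M (count_space UNIV)" and gn: "\<And>x. g x \<le> n"
      and gp: "\<And>i. i \<in> {1..n} \<Longrightarrow> prob {x \<in> space M. g x = i} = p i"
      and g0: "prob {x \<in> space M. g x = 0} = 1 - (\<Sum>i=1..n. p i)" by auto
    have "(\<Sum>i=1..Suc n. p i) \<le> (\<Sum>i=1..c. p i)"
      using Suc.prems pos by (intro sum_mono2) (auto intro: less_imp_le)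
    then have "p (Suc n) \<le> prob {x \<in> space M. g x = 0}" unfolding g0 sum by simp
    moreover have "0 \<le> p (Suc n)" using pos[of "Suc n"] Suc.prems by simp
    ultimately obtain D where D[measurable]: "D \<in> sets M" "D \<subseteq> {x \<in> space M. g x = 0}"
      "prob D = p (Suc n)"
      using atomless_intermediate_measure[OF finite_measure_axioms assms(2), of "{x \<in> space M. g x = 0}"]
      by auto
    define g' where "g' x = (if x \<in> D then Suc n else g x)" for x
    have 1: "g' \<in> measurable M (count_space UNIV)" unfolding g'_def by measurable
    have 2: "{x \<in> space M. g' x = i} = {x \<in> space M. g x = i}" if "i \<in> {1..n}" for i
      using D that by (auto simp: g'_def)
    have 3: "{x \<in> space M. g' x = Suc n} = D"
      using D gn[THEN le_imp_less_Suc, THEN less_imp_neq] sets.sets_into_space[OF D(1)]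
      by (auto simp: g'_def)
    have 4: "{x \<in> space M. g' x = 0} = {x \<in> space M. g x = 0} - D" by (auto simp: g'_def)
    have "prob {x \<in> space M. g' x = 0} = 1 - (\<Sum>i=1..Suc n. p i)"
      unfolding 4 using D by (subst finite_measure_Diff) (auto simp: g0)
    moreover have "\<forall>i\<in>{1..Suc n}. prob {x \<in> space M. g' x = i} = p i"
      using 2 3 gp D by (auto simp: le_Suc_eq)
    ultimately show ?case using 1 gn by (intro bexI[of _ g']) (auto simp: g'_def le_Suc_eq)
  qed
  from this[of c] obtain g where g[measurable]: "g \<in> measurable M (count_space UNIV)" and gn: "\<And>x. g x \<le> c"
    and gp: "\<And>i. i \<in> {1..c} \<Longrightarrow> prob {x \<in> space M. g x = i} = p i"
    and g0: "prob {x \<in> space M. g x = 0} = 0" using sum by auto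
  have "prob {x \<in> space M. max 1 (g x) = i} = p i" if i: "i \<in> {1..c}" for i
  proof -
    have "AE x in M. g x \<noteq> 0"
      using g0 by (subst AE_iff_measurable[OF _ refl]) (auto simp: emeasure_eq_measure)
    then have "prob {x \<in> space M. max 1 (g x) = i} = prob {x \<in> space M. g x = i}"
      by (intro finite_measure_eq_AE) (auto simp: max_def elim!: eventually_mono)
    then show ?thesis using gp i by simp
  qed
  then show ?thesis using gn c by (intro bexI[of _ "\<lambda>x. max 1 (g x)"]) auto
qed

section \<open>Coloured hypergraphs\<close>

definition ksubsets :: "nat \<Rightarrow> 'v set \<Rightarrow> 'v set set" where
  "ksubsets k V = {A. A \<subseteq> V \<and> finite A \<and> card A = k}"

text \<open>The colouring is a total function on sets, so the same \<open>f\<close> can be read on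
  every vertex set: restricting the structure leaves \<open>f\<close> unchanged, and a random
  \<open>\<theta>\<close> can be plugged in directly.\<close>

definition colouring_struct :: "nat \<Rightarrow> 'v set \<Rightarrow> ('v set \<Rightarrow> nat) \<Rightarrow> (nat, 'v) rstruct" where
  "colouring_struct k V f =
     \<lparr>verts = V, rel = (\<lambda>i. {xs. set xs \<subseteq> V \<and> length xs = k \<and> distinct xs \<and> f (set xs) = i})\<rparr>"

lemma verts_colouring_struct [simp]: "verts (colouring_struct k V f) = V"
  by (simp add: colouring_struct_def)

lemma set_in_ksubsets: "set xs \<subseteq> V \<Longrightarrow> distinct xs \<Longrightarrow> set xs \<in> ksubsets (length xs) V"
  by (simp add: ksubsets_def distinct_card)

lemma ksubsets_obtain_list:
  assumes "A \<in> ksubsets k V"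
  obtains xs where "set xs = A" "length xs = k" "distinct xs"
proof -
  obtain xs where "set xs = A" "distinct xs"
    using assms finite_distinct_list[of A] by (auto simp: ksubsets_def)
  then show ?thesis using that assms distinct_card[of xs] by (simp add: ksubsets_def)
qed

lemma finite_ksubsets [simp]: "finite V \<Longrightarrow> finite (ksubsets k V)"
  by (rule finite_subset[of _ "Pow V"]) (auto simp: ksubsets_def)

lemma colouring_struct_cong:
  assumes "\<And>A. A \<in> ksubsets k V \<Longrightarrow> f A = g A"
  shows "colouring_struct k V f = colouring_struct k V g"
proof -
  have "f (set xs) = g (set xs)" if "set xs \<subseteq> V" "length xs = k" "distinct xs" for xs
    using assms set_in_ksubsets that by blast
  then show ?thesis by (auto simp: colouring_struct_def fun_eq_iff)
qed

lemma colouring_struct_eq_iff: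
  "colouring_struct k V f = colouring_struct k V g \<longleftrightarrow> (\<forall>A\<in>ksubsets k V. f A = g A)"
proof
  assume eq: "colouring_struct k V f = colouring_struct k V g"
  show "\<forall>A\<in>ksubsets k V. f A = g A"
  proof
    fix A assume A: "A \<in> ksubsets k V"
    then obtain xs where xs: "set xs = A" "length xs = k" "distinct xs" by (rule ksubsets_obtain_list)
    then have "xs \<in> rel (colouring_struct k V f) (f A)"
      using A by (auto simp: colouring_struct_def ksubsets_def)
    then show "f A = g A" unfolding eq using xs by (simp add: colouring_struct_def)
  qed
qed (auto intro: colouring_struct_cong)

lemma induced_colouring_struct:
  "S \<subseteq> V \<Longrightarrow> induced (colouring_struct k V f) S = colouring_struct k S f"
  by (auto simp: induced_def colouring_struct_def fun_eq_iff)

lemma is_model_colouring_struct: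
  assumes "1 \<le> k" and f: "\<And>A. A \<in> ksubsets k V \<Longrightarrow> f A \<in> {1..c}"
  shows "is_model (col_language c k) (col_theory c k) (colouring_struct k V f)"
proof -
  have range: "f (set xs) \<in> {1..c}" if "set xs \<subseteq> V" "length xs = k" "distinct xs" for xs
    using f set_in_ksubsets that by blast
  have perm: "set (map (\<lambda>j. xs ! \<pi> j) [0..<k]) = set xs" "distinct (map (\<lambda>j. xs ! \<pi> j) [0..<k])"
    if "\<pi> permutes {..<k}" "length xs = k" "distinct xs" for xs :: "'a list" and \<pi>
  proof -
    have "map (\<lambda>j. xs ! \<pi> j) [0..<k] = permute_list \<pi> xs" using that by (simp add: permute_list_def)
    then show "set (map (\<lambda>j. xs ! \<pi> j) [0..<k]) = set xs" "distinct (map (\<lambda>j. xs ! \<pi> j) [0..<k])"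
      using that by simp_all
  qed
  show ?thesis
    unfolding is_model_col_theory_iff[OF assms(1)] is_structure_def
    using range perm by (auto simp: colouring_struct_def col_language_def simp del: set_map distinct_map)
qed

text \<open>Two enumerations of a \<open>k\<close>-set differ by a permutation of positions, so the
  symmetry axioms give them the same colour. Taking \<open>f\<close> extensional makes it unique,
  which later lets sums over models be rewritten as sums over colourings.\<close>

lemma model_col_theory_obtain:
  fixes K :: "(nat, 'v) rstruct"
  assumes k: "1 \<le> k" and K: "is_model (col_language c k) (col_theory c k) K"
  obtains f where "f \<in> ksubsets k (verts K) \<rightarrow>\<^sub>E {1..c}" "K = colouring_struct k (verts K) f"
proof -
  note M = K[unfolded is_model_col_theory_iff[OF k]]
  have perm: "ys \<in> rel K i" if "xs \<in> rel K i" "i \<in> {1..c}" "distinct ys" "set ys = set xs" for xs ys i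
  proof -
    have "distinct xs" "length xs = k"
      using M that by (auto simp: is_structure_def col_language_def)
    then have "mset ys = mset xs" using that set_eq_iff_mset_eq_distinct by blast
    then obtain \<pi> where \<pi>: "\<pi> permutes {..<k}" "permute_list \<pi> xs = ys"
      using mset_eq_permutation[of ys xs] \<open>length xs = k\<close> by metis
    then have "ys = map (\<lambda>j. xs ! \<pi> j) [0..<k]"
      using \<open>length xs = k\<close> by (auto simp: permute_list_def)
    then show ?thesis using M that(1,2) \<pi>(1) by blast
  qed
  have "\<forall>A\<in>ksubsets k (verts K). \<exists>i\<in>{1..c}. \<forall>xs. set xs = A \<and> distinct xs \<longrightarrow> xs \<in> rel K i"
  proof
    fix A assume A: "A \<in> ksubsets k (verts K)"
    then obtain xs where xs: "set xs = A" "length xs = k" "distinct xs" by (rule ksubsets_obtain_list)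
    then obtain i where "i \<in> {1..c}" "xs \<in> rel K i" using M A by (auto simp: ksubsets_def)
    then show "\<exists>i\<in>{1..c}. \<forall>xs. set xs = A \<and> distinct xs \<longrightarrow> xs \<in> rel K i"
      using perm xs by blast
  qed
  then obtain f where f: "\<And>A. A \<in> ksubsets k (verts K) \<Longrightarrow> f A \<in> {1..c}"
    "\<And>xs. set xs \<in> ksubsets k (verts K) \<Longrightarrow> distinct xs \<Longrightarrow> xs \<in> rel K (f (set xs))"
    by metis
  define g where "g = restrict f (ksubsets k (verts K))"
  have "rel K i = rel (colouring_struct k (verts K) g) i" for i
  proof (intro set_eqI iffI)
    fix xs assume xs: "xs \<in> rel K i"
    then have i: "i \<in> {1..c}" using M by (auto simp: is_structure_def col_language_def)
    have p: "set xs \<subseteq> verts K" "length xs = k" "distinct xs"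
      using M xs i by (fastforce simp: is_structure_def col_language_def)+
    then have "set xs \<in> ksubsets k (verts K)" using set_in_ksubsets by blast
    then have "xs \<in> rel K (f (set xs))" "f (set xs) \<in> {1..c}" "g (set xs) = f (set xs)"
      using f p by (auto simp: g_def)
    then have "g (set xs) = i" using M xs i p by metis
    then show "xs \<in> rel (colouring_struct k (verts K) g) i" using p by (simp add: colouring_struct_def)
  next
    fix xs assume "xs \<in> rel (colouring_struct k (verts K) g) i"
    then have p: "set xs \<subseteq> verts K" "length xs = k" "distinct xs" "g (set xs) = i"
      by (auto simp: colouring_struct_def)
    then have "set xs \<in> ksubsets k (verts K)" using set_in_ksubsets by blast
    then show "xs \<in> rel K i" using f(2) p by (auto simp: g_def)
  qed
  then have "K = colouring_struct k (verts K) g" by (simp add: fun_eq_iff colouring_struct_def)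
  moreover have "g \<in> ksubsets k (verts K) \<rightarrow>\<^sub>E {1..c}" using f by (auto simp: g_def)
  ultimately show ?thesis using that by blast
qed

lemma labeled_density_colouring_struct:
  assumes V: "finite V" and f: "f \<in> ksubsets k V \<rightarrow>\<^sub>E {1..c}"
  shows "labeled_density c k p (colouring_struct k V f) = (\<Prod>A\<in>ksubsets k V. p (f A))"
proof -
  have "{A. A \<subseteq> V \<and> card A = k \<and> (\<exists>xs\<in>rel (colouring_struct k V f) i. set xs = A)}
      = {A \<in> ksubsets k V. f A = i}"
    (is "?L = ?R") for i
  proof (intro set_eqI iffI)
    fix A assume "A \<in> ?R"
    moreover from this obtain xs where "set xs = A" "length xs = k" "distinct xs"
      by (auto elim: ksubsets_obtain_list)
    ultimately show "A \<in> ?L" by (auto simp: colouring_struct_def ksubsets_def intro!: exI[of _ xs])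
  qed (auto simp: colouring_struct_def ksubsets_def)
  then have "labeled_density c k p (colouring_struct k V f)
      = (\<Prod>i=1..c. \<Prod>A | A \<in> ksubsets k V \<and> f A = i. p (f A))"
    by (simp add: labeled_density_def)
  also have "\<dots> = (\<Prod>A\<in>ksubsets k V. p (f A))"
    using f V by (intro prod.group) auto
  finally show ?thesis .
qed

text \<open>In a coloured \<open>k\<close>-hypergraph a formula in at most \<open>k\<close> variables sees, on a tuple of distinct
  vertices, only the colour of the single \<open>k\<close>-set the tuple can span; so its truth value can be read
  off a monochromatic structure.\<close>

lemma sat_colouring_struct_monochromatic:
  assumes xs: "distinct xs" "set xs \<subseteq> V" "length xs \<le> k"
    and f: "length xs = k \<Longrightarrow> f (set xs) = i"
    and F: "wf_qf (col_language c k) F" "fvars F \<subseteq> {..<length xs}"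
  shows "sat (colouring_struct k V f) ((!) xs) F
    \<longleftrightarrow> sat (colouring_struct k UNIV (\<lambda>_. i)) (\<lambda>j. j) F"
  using F
proof (induction F)
  case (EqF a b)
  then show ?case using xs by (simp add: nth_eq_iff_index_eq)
next
  case (RelF j js)
  then have js: "length js = k" "set js \<subseteq> {..<length xs}" by (auto simp: col_language_def)
  have "inj_on ((!) xs) {..<length xs}" using xs by (simp add: inj_on_nth)
  then have inj: "inj_on ((!) xs) (set js)" using js(2) by (rule inj_on_subset)
  have sub: "(!) xs ` set js \<subseteq> V" using xs(2) js(2) by (auto simp: subset_iff)
  \<comment> \<open>A repetition-free \<open>js\<close> has \<open>k\<close> entries among the at
    most \<open>k\<close> positions of \<open>xs\<close>, so it uses all of them. A
    \<open>js\<close> with a repetition makes the atom false on both sides.\<close>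
  have "f ((!) xs ` set js) = i" if "distinct js"
  proof -
    have "card (set js) = k" using that js(1) distinct_card by blast
    moreover have "card (set js) \<le> length xs" using card_mono[OF _ js(2)] by simp
    ultimately have len: "length xs = k" using xs(3) by simp
    then have "set js = {..<length xs}"
      using js(2) \<open>card (set js) = k\<close> by (intro card_subset_eq) auto
    then have "(!) xs ` set js = set xs" by (auto simp: set_conv_nth)
    then show ?thesis using f len by simp
  qed
  then show ?case using js inj sub by (auto simp: colouring_struct_def distinct_map)
qed auto

section \<open>Isomorphism classes and interpretations\<close>

lemma sat_induced:
  "s ` fvars F \<subseteq> S \<Longrightarrow> sat (induced K S) s F \<longleftrightarrow> sat K s F"
  by (induction F) (auto simp: induced_def)

text \<open>A quantifier-free formula inspects only the vertices assigned to its variables. The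
  bound on \<open>fvars\<close> guarantees that these are entries of \<open>xs\<close>, since
  \<open>(!) xs\<close> is unspecified beyond its length.\<close>

lemma induced_interp:
  assumes I: "\<And>P. P \<in> preds L \<Longrightarrow> fvars (I P) \<subseteq> {..<arity L P}" and S: "S \<subseteq> verts K"
  shows "induced (interp L I K) S = interp L I (induced K S)"
proof -
  have "sat (induced K S) ((!) xs) (I P) \<longleftrightarrow> sat K ((!) xs) (I P)"
    if "P \<in> preds L" "length xs = arity L P" "set xs \<subseteq> S" for P xs
  proof (rule sat_induced)
    show "(!) xs ` fvars (I P) \<subseteq> S"
      using I[OF that(1)] that(2,3) by (auto simp: subset_iff)
  qed
  then have "rel (induced (interp L I K) S) P = rel (interp L I (induced K S)) P" for P
    using S by (auto simp: interp_def induced_def)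
  then show ?thesis by (simp add: interp_def induced_def fun_eq_iff)
qed

lemma isomorphic_refl: "isomorphic L K K"
  unfolding isomorphic_def by (intro exI[of _ "\<lambda>x. x"]) (auto simp: bij_betw_def)

lemma isomorphic_sym:
  assumes "isomorphic L K K'"
  shows "isomorphic L K' K"
proof -
  obtain f where f: "bij_betw f (verts K) (verts K')"
    and eq: "\<And>P xs. P \<in> preds L \<Longrightarrow> set xs \<subseteq> verts K \<Longrightarrow> xs \<in> rel K P \<longleftrightarrow> map f xs \<in> rel K' P"
    using assms by (auto simp: isomorphic_def)
  let ?g = "inv_into (verts K) f"
  have "ys \<in> rel K' P \<longleftrightarrow> map ?g ys \<in> rel K P" if "P \<in> preds L" "set ys \<subseteq> verts K'" for P ys
  proof -
    have im: "f ` verts K = verts K'" using f by (simp add: bij_betw_def)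
    have "map f (map ?g ys) = ys"
      unfolding map_map by (rule map_idI) (use that(2) im in \<open>auto simp: f_inv_into_f\<close>)
    moreover have "set (map ?g ys) \<subseteq> verts K"
      using that(2) im by (auto intro!: inv_into_into)
    ultimately show ?thesis using eq[OF that(1)] by metis
  qed
  then show ?thesis using bij_betw_inv_into[OF f] unfolding isomorphic_def by blast
qed

lemma isomorphic_trans:
  assumes "isomorphic L K K'" "isomorphic L K' K''"
  shows "isomorphic L K K''"
proof -
  obtain f where f: "bij_betw f (verts K) (verts K')"
    and eqf: "\<And>P xs. P \<in> preds L \<Longrightarrow> set xs \<subseteq> verts K \<Longrightarrow> xs \<in> rel K P \<longleftrightarrow> map f xs \<in> rel K' P"
    using assms by (auto simp: isomorphic_def)
  obtain g where g: "bij_betw g (verts K') (verts K'')"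
    and eqg: "\<And>P xs. P \<in> preds L \<Longrightarrow> set xs \<subseteq> verts K' \<Longrightarrow> xs \<in> rel K' P \<longleftrightarrow> map g xs \<in> rel K'' P"
    using assms by (auto simp: isomorphic_def)
  have "xs \<in> rel K P \<longleftrightarrow> map (g \<circ> f) xs \<in> rel K'' P" if "P \<in> preds L" "set xs \<subseteq> verts K" for P xs
  proof -
    have "set (map f xs) \<subseteq> verts K'" using f that by (auto simp: bij_betw_def)
    then show ?thesis using eqf[OF that] eqg[OF that(1), of "map f xs"] by simp
  qed
  then show ?thesis using bij_betw_trans[OF f g] unfolding isomorphic_def by blast
qed

text \<open>An isomorphism preserves the truth of quantifier-free formulas. Well-formedness enters
  because \<open>isomorphic\<close> compares only the predicates of the language.\<close>

lemma isomorphic_interp: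
  assumes I: "\<And>P. P \<in> preds L1 \<Longrightarrow> wf_qf L2 (I P) \<and> fvars (I P) \<subseteq> {..<arity L1 P}"
    and iso: "isomorphic L2 K K'"
  shows "isomorphic L1 (interp L1 I K) (interp L1 I K')"
proof -
  obtain f where f: "bij_betw f (verts K) (verts K')"
    and eq: "\<And>P xs. P \<in> preds L2 \<Longrightarrow> set xs \<subseteq> verts K \<Longrightarrow> xs \<in> rel K P \<longleftrightarrow> map f xs \<in> rel K' P"
    using iso by (auto simp: isomorphic_def)
  have inj: "inj_on f (verts K)" and im: "f ` verts K = verts K'" using f by (auto simp: bij_betw_def)
  have sat: "sat K' (f \<circ> s) F \<longleftrightarrow> sat K s F" if "wf_qf L2 F" "s ` fvars F \<subseteq> verts K" for s F
    using that
  proof (induction F)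
    case (EqF i j)
    then show ?case using inj by (auto simp: inj_on_def)
  next
    case (RelF P js)
    then show ?case using eq[of P "map s js"] by (simp add: comp_def)
  qed auto
  have "xs \<in> rel (interp L1 I K) P \<longleftrightarrow> map f xs \<in> rel (interp L1 I K') P"
    if P: "P \<in> preds L1" and xs: "set xs \<subseteq> verts K" for P xs
  proof (cases "length xs = arity L1 P")
    case True
    have "sat K' ((!) (map f xs)) (I P) \<longleftrightarrow> sat K' (f \<circ> (!) xs) (I P)"
      using I[OF P] True by (intro sat_cong) auto
    also have "\<dots> \<longleftrightarrow> sat K ((!) xs) (I P)"
      using I[OF P] True xs by (intro sat) (auto simp: subset_iff)
    finally show ?thesis using P True xs im by (auto simp: interp_def)
  qed (auto simp: interp_def)
  then show ?thesis
    unfolding isomorphic_def by (intro exI[of _ f]) (use f in \<open>simp add: interp_def\<close>)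
qed

section \<open>Isomorphism classes as classes of an equivalence relation\<close>

definition iso_rel :: "'p language \<Rightarrow> 'p qf set \<Rightarrow> (('p, nat) rstruct \<times> ('p, nat) rstruct) set" where
  "iso_rel L T = {(K, K'). K \<in> fin_models L T \<and> K' \<in> fin_models L T \<and> isomorphic L K K'}"

lemma iclasses_quotient: "iclasses L T = fin_models L T // iso_rel L T"
  by (simp add: iclasses_def iso_rel_def)

lemma equiv_iso_rel: "equiv (fin_models L T) (iso_rel L T)"
  unfolding equiv_def refl_on_def sym_def trans_def iso_rel_def
  by (auto intro: isomorphic_refl isomorphic_sym isomorphic_trans)

lemma iclass_of_in_iclasses: "K \<in> fin_models L T \<Longrightarrow> iso_rel L T `` {K} \<in> iclasses L T"
  by (simp add: iclasses_quotient quotientI)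

lemma iclass_eq_iff:
  assumes "M \<in> iclasses L T" "K \<in> fin_models L T"
  shows "iso_rel L T `` {K} = M \<longleftrightarrow> K \<in> M"
proof
  assume "K \<in> M"
  obtain K0 where "M = iso_rel L T `` {K0}"
    using assms(1) unfolding iclasses_quotient by (rule quotientE)
  with \<open>K \<in> M\<close> show "iso_rel L T `` {K} = M"
    using equiv_class_eq[OF equiv_iso_rel, of K0 K] by blast
next
  assume "iso_rel L T `` {K} = M"
  then show "K \<in> M" using equiv_class_self[OF equiv_iso_rel assms(2)] by blast
qed

lemma iclasses_memberD:
  assumes "M \<in> iclasses L T" "K \<in> M"
  shows "K \<in> fin_models L T" "card (verts K) = csize M"
    "K' \<in> M \<longleftrightarrow> K' \<in> fin_models L T \<and> isomorphic L K K'"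
proof -
  show K: "K \<in> fin_models L T"
    using in_quotient_imp_subset[OF equiv_iso_rel] assms unfolding iclasses_quotient by blast
  then have M: "M = iso_rel L T `` {K}" using iclass_eq_iff[OF assms(1) K] assms(2) by blast
  show "K' \<in> M \<longleftrightarrow> K' \<in> fin_models L T \<and> isomorphic L K K'"
    unfolding M using K by (simp add: iso_rel_def)
  have "(SOME K. K \<in> M) \<in> M" using assms(2) by (rule someI)
  then have "(K, SOME K. K \<in> M) \<in> iso_rel L T" using M by blast
  then have "isomorphic L K (SOME K. K \<in> M)" by (simp add: iso_rel_def)
  then show "card (verts K) = csize M"
    unfolding csize_def isomorphic_def by (auto intro: bij_betw_same_card)
qed

lemma iclasses_nonempty: "M \<in> iclasses L T \<Longrightarrow> M \<noteq> {}"
  unfolding iclasses_quotient by (rule in_quotient_imp_non_empty[OF equiv_iso_rel])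

text \<open>Members of a class live on arbitrary finite sets of numbers, but
  \<open>quasirandom_limit\<close> sums only over those on an initial segment. Pulling the colouring
  back along a bijection provides one there.\<close>

lemma colour_iclass_representative:
  assumes k: "1 \<le> k" and N: "N \<in> iclasses (col_language c k) (col_theory c k)"
  obtains f where "f \<in> ksubsets k {..<csize N} \<rightarrow>\<^sub>E {1..c}" "colouring_struct k {..<csize N} f \<in> N"
proof -
  let ?n = "csize N"
  obtain K where K: "K \<in> N" using iclasses_nonempty[OF N] by blast
  note KD = iclasses_memberD[OF N K]
  have fin: "finite (verts K)" and mod: "is_model (col_language c k) (col_theory c k) K"
    using KD(1) by (auto simp: fin_models_def)
  obtain f where f: "f \<in> ksubsets k (verts K) \<rightarrow>\<^sub>E {1..c}" "K = colouring_struct k (verts K) f"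
    using model_col_theory_obtain[OF k mod] .
  obtain h where h: "bij_betw h {..<?n} (verts K)"
    using ex_bij_betw_nat_finite[OF fin] KD(2) by (auto simp: atLeast0LessThan)
  define f' where "f' = (\<lambda>A\<in>ksubsets k {..<?n}. f (h ` A))"
  have "h ` A \<in> ksubsets k (verts K)" if "A \<in> ksubsets k {..<?n}" for A
    using that h card_image[of h A] by (auto simp: ksubsets_def bij_betw_def intro: inj_on_subset)
  then have f': "f' \<in> ksubsets k {..<?n} \<rightarrow>\<^sub>E {1..c}" using f(1) by (auto simp: f'_def PiE_def Pi_iff)
  let ?K = "colouring_struct k {..<?n} f'"
  have model: "?K \<in> fin_models (col_language c k) (col_theory c k)"
    using is_model_colouring_struct[OF k PiE_mem[OF f']] by (simp add: fin_models_def)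
  have "xs \<in> rel ?K i \<longleftrightarrow> map h xs \<in> rel K i" if xs: "set xs \<subseteq> {..<?n}" for xs i
  proof -
    have inj: "inj_on h (set xs)" and sub: "h ` set xs \<subseteq> verts K"
      using h xs by (auto simp: bij_betw_def intro: inj_on_subset)
    have "f' (set xs) = f (h ` set xs)" if "distinct xs" "length xs = k"
      using set_in_ksubsets[OF xs that(1)] that(2) by (simp add: f'_def)
    then show ?thesis
      by (subst f(2)) (use xs inj sub in \<open>auto simp: colouring_struct_def distinct_map\<close>)
  qed
  then have "isomorphic (col_language c k) ?K K"
    using h unfolding isomorphic_def by (intro exI[of _ h]) auto
  then have "?K \<in> N" using KD(3) model isomorphic_sym by blast
  then show ?thesis using that f' by blast
qed

text \<open>The left side is a double sum: over classes \<open>N\<close> whose interpretation falls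
  in \<open>M\<close>, and over the labelled members of \<open>N\<close>. Whether the interpretation
  of a colouring falls in \<open>M\<close> depends only on its class, so the classes partition the
  admissible colourings and the double sum collapses.\<close>

lemma interp_limit_quasirandom_limit:
  fixes I :: "'p \<Rightarrow> nat qf"
  assumes k: "1 \<le> k"
    and I: "open_interpretation L T (col_language c k) (col_theory c k) I"
    and M: "M \<in> iclasses L T"
  shows "interp_limit L T (col_language c k) (col_theory c k) I (quasirandom_limit c k p) M =
    (\<Sum>f | f \<in> ksubsets k {..<csize M} \<rightarrow>\<^sub>E {1..c} \<and>
           interp L I (colouring_struct k {..<csize M} f) \<in> M.
       \<Prod>A\<in>ksubsets k {..<csize M}. p (f A))"
proof -
  let ?LC = "col_language c k" and ?TC = "col_theory c k" and ?n = "csize M"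
  let ?K = "colouring_struct k {..<?n}"
  define F where "F = {f \<in> ksubsets k {..<?n} \<rightarrow>\<^sub>E {1..c}. interp L I (?K f) \<in> M}"
  define cls where "cls f = iso_rel ?LC ?TC `` {?K f}" for f
  have finF: "finite F" unfolding F_def by (intro finite_subset[OF _ finite_PiE[of "ksubsets k {..<?n}" "\<lambda>_. {1..c}"]]) auto
  have model: "?K f \<in> fin_models ?LC ?TC" if "f \<in> ksubsets k {..<?n} \<rightarrow>\<^sub>E {1..c}" for f
    using is_model_colouring_struct[OF k PiE_mem[OF that]] by (simp add: fin_models_def)
  have Iwf: "wf_qf ?LC (I P) \<and> fvars (I P) \<subseteq> {..<arity L P}" if "P \<in> preds L" for P
    using I that by (auto simp: open_interpretation_def)
  \<comment> \<open>The index set of \<open>interp_limit\<close> asks for one suitable member of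
    \<open>N\<close>; invariance under isomorphism makes every member suitable.\<close>
  have interp_in: "interp L I K' \<in> M"
    if N: "N \<in> iclasses ?LC ?TC" and K: "K \<in> N" "K' \<in> N" "interp L I K \<in> M" for N K K'
  proof -
    have "isomorphic ?LC K K'" "K' \<in> fin_models ?LC ?TC"
      using iclasses_memberD(3)[OF N K(1)] K(2) by auto
    then have "isomorphic L (interp L I K) (interp L I K')" "interp L I K' \<in> fin_models L T"
      using isomorphic_interp[OF Iwf] I by (auto simp: fin_models_def open_interpretation_def) (auto simp: interp_def)
    then show ?thesis using iclasses_memberD(3)[OF M K(3)] by simp
  qed
  have index: "{N \<in> iclasses ?LC ?TC. csize N = ?n \<and> (\<exists>K\<in>N. interp L I K \<in> M)} = cls ` F"
  proof (intro set_eqI iffI)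
    fix N assume "N \<in> {N \<in> iclasses ?LC ?TC. csize N = ?n \<and> (\<exists>K\<in>N. interp L I K \<in> M)}"
    then obtain K where N: "N \<in> iclasses ?LC ?TC" "csize N = ?n" "K \<in> N" "interp L I K \<in> M" by blast
    obtain f where f: "f \<in> ksubsets k {..<?n} \<rightarrow>\<^sub>E {1..c}" "?K f \<in> N"
      using colour_iclass_representative[OF k N(1)] N(2) by metis
    then have "f \<in> F" using interp_in[OF N(1,3) f(2) N(4)] by (simp add: F_def)
    moreover have "cls f = N" unfolding cls_def using iclass_eq_iff[OF N(1) model[OF f(1)]] f(2) by simp
    ultimately show "N \<in> cls ` F" by blast
  next
    fix N assume "N \<in> cls ` F"
    then obtain f where f: "f \<in> F" "N = cls f" by blast
    then have m: "?K f \<in> fin_models ?LC ?TC" by (intro model) (simp add: F_def)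
    then have N: "N \<in> iclasses ?LC ?TC" using f iclass_of_in_iclasses by (simp add: cls_def)
    then have KN: "?K f \<in> N" using iclass_eq_iff[OF N m] f by (simp add: cls_def)
    then show "N \<in> {N \<in> iclasses ?LC ?TC. csize N = ?n \<and> (\<exists>K\<in>N. interp L I K \<in> M)}"
      using N f iclasses_memberD(2)[OF N KN] by (auto simp: F_def)
  qed
  have inner: "quasirandom_limit c k p N = (\<Sum>f | f \<in> F \<and> cls f = N. \<Prod>A\<in>ksubsets k {..<?n}. p (f A))"
    if "N \<in> cls ` F" for N
  proof -
    from that obtain K where N: "N \<in> iclasses ?LC ?TC" "csize N = ?n" and K: "K \<in> N" "interp L I K \<in> M"
      using index by blast
    \<comment> \<open>Each member of \<open>N\<close> on the initial segment comes from exactly one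
      extensional colouring, so the sum in \<open>quasirandom_limit\<close> can be reindexed by
      colourings.\<close>
    have "bij_betw ?K {f \<in> F. cls f = N} {K \<in> N. verts K = {..<?n}}"
    proof (rule bij_betwI')
      fix f g assume "f \<in> {f \<in> F. cls f = N}" "g \<in> {f \<in> F. cls f = N}"
      then have "f \<in> ksubsets k {..<?n} \<rightarrow>\<^sub>E {1..c}" "g \<in> ksubsets k {..<?n} \<rightarrow>\<^sub>E {1..c}"
        unfolding F_def by blast+
      then show "?K f = ?K g \<longleftrightarrow> f = g"
        unfolding colouring_struct_eq_iff by (metis PiE_ext)
    next
      fix f assume f: "f \<in> {f \<in> F. cls f = N}"
      then have "f \<in> F" by blast
      then have "f \<in> ksubsets k {..<?n} \<rightarrow>\<^sub>E {1..c}" unfolding F_def by blast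
      then have "?K f \<in> fin_models ?LC ?TC" by (rule model)
      from iclass_eq_iff[OF N(1) this] f have "?K f \<in> N" unfolding cls_def by blast
      then show "?K f \<in> {K \<in> N. verts K = {..<?n}}" by simp
    next
      fix K' assume K': "K' \<in> {K \<in> N. verts K = {..<?n}}"
      then have m: "K' \<in> fin_models ?LC ?TC" using iclasses_memberD(1)[OF N(1)] by blast
      then have "is_model ?LC ?TC K'" by (simp add: fin_models_def)
      then obtain f where f: "f \<in> ksubsets k {..<?n} \<rightarrow>\<^sub>E {1..c}" "K' = ?K f"
        using model_col_theory_obtain[OF k] K' by (metis (mono_tags, lifting) mem_Collect_eq)
      moreover have "f \<in> F" using f interp_in[OF N(1) K(1) _ K(2)] K' by (simp add: F_def)
      moreover have "cls f = N" unfolding cls_def using iclass_eq_iff[OF N(1) m] f K' by simp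
      ultimately show "\<exists>f\<in>{f \<in> F. cls f = N}. K' = ?K f" by blast
    qed
    then have "(\<Sum>K | K \<in> N \<and> verts K = {..<?n}. labeled_density c k p K)
        = (\<Sum>f | f \<in> F \<and> cls f = N. labeled_density c k p (?K f))"
      by (rule sum.reindex_bij_betw[symmetric])
    also have "\<dots> = (\<Sum>f | f \<in> F \<and> cls f = N. \<Prod>A\<in>ksubsets k {..<?n}. p (f A))"
      by (intro sum.cong labeled_density_colouring_struct) (auto simp: F_def)
    finally show ?thesis using N by (simp add: quasirandom_limit_def)
  qed
  have "interp_limit L T ?LC ?TC I (quasirandom_limit c k p) M
      = (\<Sum>N\<in>cls ` F. \<Sum>f | f \<in> F \<and> cls f = N. \<Prod>A\<in>ksubsets k {..<?n}. p (f A))"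
    unfolding interp_limit_def using M index by (simp add: inner)
  also have "\<dots> = (\<Sum>f\<in>F. \<Prod>A\<in>ksubsets k {..<?n}. p (f A))"
    using finF by (intro sum.group) auto
  finally show ?thesis unfolding F_def .
qed

section \<open>Random colourings\<close>

lemma space_E_space: "space (E_space V \<Omega>) = (\<Pi>\<^sub>E A\<in>fin_ne_subsets V. space \<Omega>)"
  by (simp add: E_space_def space_PiM)

lemma prob_space_E_space: "prob_space \<Omega> \<Longrightarrow> prob_space (E_space V \<Omega>)"
  unfolding E_space_def by (intro prob_space.prob_space_completion prob_space_PiM)

lemma ksubsets_subset_fin_ne: "1 \<le> k \<Longrightarrow> V \<subseteq> W \<Longrightarrow> ksubsets k V \<subseteq> fin_ne_subsets W"
  by (auto simp: ksubsets_def fin_ne_subsets_def)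

text \<open>The event constrains finitely many independent coordinates. It is already measurable for
  the product itself, so passing to the completion does not change its measure.\<close>

lemma E_space_cylinder:
  fixes f :: "'v set \<Rightarrow> nat"
  assumes "prob_space \<Omega>" and A: "finite \<A>" "\<A> \<subseteq> fin_ne_subsets V"
    and g: "g \<in> measurable \<Omega> (count_space UNIV)"
  defines "Z \<equiv> {\<theta> \<in> space (E_space V \<Omega>). \<forall>A\<in>\<A>. g (\<theta> A) = f A}"
  shows "Z \<in> sets (E_space V \<Omega>)"
    and "measure (E_space V \<Omega>) Z = (\<Prod>A\<in>\<A>. measure \<Omega> {x \<in> space \<Omega>. g x = f A})"
proof -
  interpret \<Omega>: prob_space \<Omega> by fact
  interpret product_prob_space "\<lambda>_. \<Omega>" "fin_ne_subsets V" by (simp add: product_prob_spaceI assms(1))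
  let ?P = "Pi\<^sub>M (fin_ne_subsets V) (\<lambda>_. \<Omega>)"
  let ?X = "\<lambda>A. {x \<in> space \<Omega>. g x = f A}"
  have X: "?X A \<in> sets \<Omega>" for A using g by measurable
  have sp: "\<theta> A \<in> space \<Omega>" if "\<theta> \<in> space ?P" "A \<in> \<A>" for \<theta> A
    using that A(2) by (auto simp: space_PiM)
  have Z: "Z = {\<theta> \<in> space ?P. \<forall>A\<in>\<A>. \<theta> A \<in> ?X A}"
    using sp by (auto simp: Z_def E_space_def)
  have "{\<theta> \<in> space ?P. \<theta> A \<in> ?X A} \<in> sets ?P" if "A \<in> \<A>" for A
    using X A(2) that by (intro sets_Collect_single) auto
  then have sets: "Z \<in> sets ?P" unfolding Z using A(1) by (intro sets.sets_Collect_finite_All) auto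
  then show "Z \<in> sets (E_space V \<Omega>)" by (simp add: E_space_def)
  have "emeasure ?P Z = (\<Prod>A\<in>\<A>. emeasure \<Omega> (?X A))"
    unfolding Z using A X by (intro emeasure_PiM_Collect) auto
  then have "measure ?P Z = (\<Prod>A\<in>\<A>. measure \<Omega> (?X A))"
    by (intro measure_eq_emeasure_eq_ennreal) (simp_all add: \<Omega>.emeasure_eq_measure prod_ennreal prod_nonneg)
  then show "measure (E_space V \<Omega>) Z = (\<Prod>A\<in>\<A>. measure \<Omega> (?X A))"
    using sets by (simp add: E_space_def)
qed

lemma theon_limit_colouring:
  fixes I :: "'p \<Rightarrow> nat qf"
  assumes k: "1 \<le> k" and \<Omega>: "prob_space \<Omega>"
    and g: "g \<in> measurable \<Omega> (count_space UNIV)" "\<And>x. g x \<in> {1..c}"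
    and p: "\<And>i. i \<in> {1..c} \<Longrightarrow> measure \<Omega> {x \<in> space \<Omega>. g x = i} = p i"
    and I: "open_interpretation L T (col_language c k) (col_theory c k) I"
    and ae: "AE \<theta> in E_space UNIV \<Omega>. theon_struct L N \<theta> = interp L I (colouring_struct k UNIV (\<lambda>A. g (\<theta> A)))"
  shows "theon_limit \<Omega> L T N = interp_limit L T (col_language c k) (col_theory c k) I (quasirandom_limit c k p)"
proof
  fix M
  show "theon_limit \<Omega> L T N M = interp_limit L T (col_language c k) (col_theory c k) I (quasirandom_limit c k p) M"
  proof (cases "M \<in> iclasses L T")
    case False
    then show ?thesis by (simp add: theon_limit_def interp_limit_def)
  next
    case M: True
    define n where "n = csize M"
    let ?E = "E_space UNIV \<Omega>" and ?K = "colouring_struct k {..<n}" and ?S = "ksubsets k {..<n}"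
    interpret E: prob_space ?E using \<Omega> by (rule prob_space_E_space)
    define F where "F = {f \<in> ?S \<rightarrow>\<^sub>E {1..c}. interp L I (?K f) \<in> M}"
    have finF: "finite F" unfolding F_def by (intro finite_subset[OF _ finite_PiE[of ?S "\<lambda>_. {1..c}"]]) auto
    define Z where "Z f = {\<theta> \<in> space ?E. \<forall>A\<in>?S. g (\<theta> A) = f A}" for f
    have Z: "Z f \<in> sets ?E" "measure ?E (Z f) = (\<Prod>A\<in>?S. measure \<Omega> {x \<in> space \<Omega>. g x = f A})" for f
      unfolding Z_def using E_space_cylinder[OF \<Omega> _ ksubsets_subset_fin_ne[OF k] g(1), of "{..<n}" UNIV] by auto
    have UZ: "(\<Union>f\<in>F. Z f) \<in> sets ?E" using Z(1) finF by auto
    have iff: "induced (theon_struct L N \<theta>) {..<n} \<in> M \<longleftrightarrow> \<theta> \<in> (\<Union>f\<in>F. Z f)"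
      if \<theta>: "\<theta> \<in> space ?E" and eq: "theon_struct L N \<theta> = interp L I (colouring_struct k UNIV (\<lambda>A. g (\<theta> A)))" for \<theta>
    proof -
      let ?f = "\<lambda>A\<in>?S. g (\<theta> A)"
      have "induced (theon_struct L N \<theta>) {..<n} = interp L I (?K (\<lambda>A. g (\<theta> A)))"
        unfolding eq using I by (subst induced_interp) (auto simp: open_interpretation_def induced_colouring_struct)
      also have "?K (\<lambda>A. g (\<theta> A)) = ?K ?f" by (intro colouring_struct_cong) simp
      finally have 1: "induced (theon_struct L N \<theta>) {..<n} = interp L I (?K ?f)" .
      have f: "?f \<in> F" if "interp L I (?K ?f) \<in> M" using g(2) that by (simp add: F_def)
      have Zf: "\<theta> \<in> Z ?f" using \<theta> by (simp add: Z_def)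
      have eqf: "f = ?f" if "f \<in> F" "\<theta> \<in> Z f" for f
      proof
        fix A
        have "f \<in> ?S \<rightarrow>\<^sub>E {1..c}" using that by (simp add: F_def)
        then have "f A = undefined" if "A \<notin> ?S" using that by (rule PiE_arb)
        then show "f A = ?f A" using that(2) by (cases "A \<in> ?S") (simp_all add: Z_def)
      qed
      have "interp L I (?K ?f) \<in> M \<longleftrightarrow> (\<exists>f\<in>F. \<theta> \<in> Z f)"
      proof
        assume "\<exists>f\<in>F. \<theta> \<in> Z f"
        then obtain f where "f \<in> F" "\<theta> \<in> Z f" by blast
        then have "?f \<in> F" using eqf by metis
        then show "interp L I (?K ?f) \<in> M" by (simp add: F_def)
      qed (use f Zf in blast)
      then show ?thesis unfolding 1 by simp
    qed
    have "theon_limit \<Omega> L T N M = measure ?E {\<theta> \<in> space ?E. induced (theon_struct L N \<theta>) {..<n} \<in> M}"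
      using M by (simp add: theon_limit_def n_def)
    also have "\<dots> = measure ?E (\<Union>f\<in>F. Z f)"
    proof (rule E.finite_measure_eq_AE)
      show eq: "AE \<theta> in ?E. \<theta> \<in> {\<theta> \<in> space ?E. induced (theon_struct L N \<theta>) {..<n} \<in> M} \<longleftrightarrow> \<theta> \<in> (\<Union>f\<in>F. Z f)"
        using ae AE_space by eventually_elim (use iff in blast)
      interpret complete_measure ?E unfolding E_space_def by (rule completion.complete_measure_axioms)
      show "{\<theta> \<in> space ?E. induced (theon_struct L N \<theta>) {..<n} \<in> M} \<in> sets ?E"
        by (rule in_sets_AE[OF _ UZ]) (use eq in \<open>auto elim: eventually_mono\<close>)
    qed (rule UZ)
    also have "\<dots> = (\<Sum>f\<in>F. measure ?E (Z f))"
    proof (rule E.finite_measure_finite_Union[OF finF])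
      show "disjoint_family_on Z F"
      proof (unfold disjoint_family_on_def, intro ballI impI)
        fix f h assume "f \<in> F" "h \<in> F" "f \<noteq> h"
        then have "f \<in> ?S \<rightarrow>\<^sub>E {1..c}" "h \<in> ?S \<rightarrow>\<^sub>E {1..c}" by (auto simp: F_def)
        with \<open>f \<noteq> h\<close> obtain A where "A \<in> ?S" "f A \<noteq> h A" by (meson PiE_ext)
        then show "Z f \<inter> Z h = {}" by (auto simp: Z_def)
      qed
    qed (use Z in auto)
    also have "\<dots> = (\<Sum>f\<in>F. \<Prod>A\<in>?S. p (f A))"
      unfolding Z by (intro sum.cong prod.cong refl p) (auto simp: F_def)
    also have "\<dots> = interp_limit L T (col_language c k) (col_theory c k) I (quasirandom_limit c k p) M"
      unfolding interp_limit_quasirandom_limit[OF k I M] F_def n_def ..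
    finally show ?thesis .
  qed
qed

section \<open>Independent peons\<close>

lemma merge_image_Collect:
  assumes "I \<inter> J = {}"
  shows "merge I J ` ((\<Pi>\<^sub>E A\<in>I. S) \<times> {h \<in> \<Pi>\<^sub>E A\<in>J. S. Q h}) =
    {x \<in> \<Pi>\<^sub>E A\<in>I \<union> J. S. Q (restrict x J)}"
proof (intro set_eqI iffI)
  fix x assume "x \<in> merge I J ` ((\<Pi>\<^sub>E A\<in>I. S) \<times> {h \<in> \<Pi>\<^sub>E A\<in>J. S. Q h})"
  then obtain y h where x: "x = merge I J (y, h)" "y \<in> (\<Pi>\<^sub>E A\<in>I. S)" "h \<in> (\<Pi>\<^sub>E A\<in>J. S)" "Q h"
    by auto
  have "restrict x J = h"
  proof
    show "restrict x J A = h A" for A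
      using assms x PiE_arb[OF x(3), of A] by (cases "A \<in> J") (auto simp: merge_def)
  qed
  moreover have "x \<in> (\<Pi>\<^sub>E A\<in>I \<union> J. S)"
    using x PiE_mem[OF x(2)] PiE_mem[OF x(3)] by (intro PiE_I) (auto simp: merge_def)
  ultimately show "x \<in> {x \<in> \<Pi>\<^sub>E A\<in>I \<union> J. S. Q (restrict x J)}" using x by simp
next
  fix x assume "x \<in> {x \<in> \<Pi>\<^sub>E A\<in>I \<union> J. S. Q (restrict x J)}"
  then have x: "x \<in> (\<Pi>\<^sub>E A\<in>I \<union> J. S)" "Q (restrict x J)" by auto
  have "x = merge I J (restrict x I, restrict x J)"
  proof
    show "x A = merge I J (restrict x I, restrict x J) A" for A
      using PiE_arb[OF x(1), of A] by (simp add: merge_def)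
  qed
  moreover have "restrict x I \<in> (\<Pi>\<^sub>E A\<in>I. S)" "restrict x J \<in> (\<Pi>\<^sub>E A\<in>J. S)"
    using PiE_mem[OF x(1)] by auto
  ultimately show "x \<in> merge I J ` ((\<Pi>\<^sub>E A\<in>I. S) \<times> {h \<in> \<Pi>\<^sub>E A\<in>J. S. Q h})"
    using x(2) by (intro image_eqI[of _ _ "(restrict x I, restrict x J)"]) auto
qed

lemma independent_peon_iff:
  "independent_peon \<Omega> m l N \<longleftrightarrow>
    (\<exists>Q. N = {x \<in> \<Pi>\<^sub>E A\<in>fin_ne_subsets {..<m}. space \<Omega>.
             Q (restrict x {A \<in> fin_ne_subsets {..<m}. l < card A})})"
proof -
  let ?I = "{A \<in> fin_ne_subsets {..<m}. card A \<le> l}"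
  let ?J = "{A \<in> fin_ne_subsets {..<m}. l < card A}"
  have IJ: "?I \<inter> ?J = {}" "?I \<union> ?J = fin_ne_subsets {..<m}" by auto
  note eq = merge_image_Collect[OF IJ(1), where S="space \<Omega>", unfolded IJ(2)]
  show ?thesis unfolding independent_peon_def Let_def
  proof
    assume "\<exists>H\<subseteq>\<Pi>\<^sub>E A\<in>?J. space \<Omega>. N = merge ?I ?J ` ((\<Pi>\<^sub>E A\<in>?I. space \<Omega>) \<times> H)"
    then obtain H where H: "H \<subseteq> (\<Pi>\<^sub>E A\<in>?J. space \<Omega>)" "N = merge ?I ?J ` ((\<Pi>\<^sub>E A\<in>?I. space \<Omega>) \<times> H)"
      by blast
    have "{h \<in> \<Pi>\<^sub>E A\<in>?J. space \<Omega>. h \<in> H} = H" using H(1) by blast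
    then have "N = {x \<in> \<Pi>\<^sub>E A\<in>fin_ne_subsets {..<m}. space \<Omega>. restrict x ?J \<in> H}"
      unfolding H(2) using eq[of "\<lambda>h. h \<in> H"] by (simp only:)
    then show "\<exists>Q. N = {x \<in> \<Pi>\<^sub>E A\<in>fin_ne_subsets {..<m}. space \<Omega>. Q (restrict x ?J)}"
      by (rule exI[of _ "\<lambda>h. h \<in> H"])
  next
    assume "\<exists>Q. N = {x \<in> \<Pi>\<^sub>E A\<in>fin_ne_subsets {..<m}. space \<Omega>. Q (restrict x ?J)}"
    then obtain Q where "N = {x \<in> \<Pi>\<^sub>E A\<in>fin_ne_subsets {..<m}. space \<Omega>. Q (restrict x ?J)}" by blast
    then show "\<exists>H\<subseteq>\<Pi>\<^sub>E A\<in>?J. space \<Omega>. N = merge ?I ?J ` ((\<Pi>\<^sub>E A\<in>?I. space \<Omega>) \<times> H)"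
      unfolding eq[symmetric] by (intro exI[of _ "{h \<in> \<Pi>\<^sub>E A\<in>?J. space \<Omega>. Q h}"]) auto
  qed
qed

lemma large_subsets_eq:
  assumes "1 \<le> k"
  shows "{A \<in> fin_ne_subsets {..<k}. k - 1 < card A} = {{..<k}}"
proof -
  have "A = {..<k}" if "A \<subseteq> {..<k}" "k - 1 < card A" for A
    using that card_mono[of "{..<k}" A] by (intro card_subset_eq) auto
  moreover have "{..<k} \<noteq> {}" using assms lessThan_empty_iff[of k] by simp
  ultimately show ?thesis using assms by (auto simp: fin_ne_subsets_def)
qed

lemma large_subsets_empty:
  assumes "m < k"
  shows "{A \<in> fin_ne_subsets {..<m}. k - 1 < card A} = {}"
proof -
  have "card A \<le> k - 1" if "A \<in> fin_ne_subsets {..<m}" for A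
    using card_mono[of "{..<m}" A] that assms by (simp add: fin_ne_subsets_def)
  then show ?thesis by (auto simp: not_less)
qed

lemma independent_peon_top_iff:
  assumes "1 \<le> k"
  shows "independent_peon \<Omega> k (k - 1) N \<longleftrightarrow>
    (\<exists>H\<subseteq>space \<Omega>. N = {x \<in> \<Pi>\<^sub>E A\<in>fin_ne_subsets {..<k}. space \<Omega>. x {..<k} \<in> H})"
proof -
  let ?r = "\<lambda>a A. if A = {..<k} then a else undefined"
  have top: "{..<k} \<in> fin_ne_subsets {..<k}" using large_subsets_eq[OF assms] by blast
  have r: "restrict x {{..<k}} = ?r (x {..<k})" for x :: "nat set \<Rightarrow> 'a" by (auto simp: fun_eq_iff)
  show ?thesis unfolding independent_peon_iff large_subsets_eq[OF assms] r
  proof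
    assume "\<exists>Q. N = {x \<in> \<Pi>\<^sub>E A\<in>fin_ne_subsets {..<k}. space \<Omega>. Q (?r (x {..<k}))}"
    then obtain Q where "N = {x \<in> \<Pi>\<^sub>E A\<in>fin_ne_subsets {..<k}. space \<Omega>. Q (?r (x {..<k}))}" by blast
    then show "\<exists>H\<subseteq>space \<Omega>. N = {x \<in> \<Pi>\<^sub>E A\<in>fin_ne_subsets {..<k}. space \<Omega>. x {..<k} \<in> H}"
      using PiE_mem[OF _ top] by (intro exI[of _ "{a \<in> space \<Omega>. Q (?r a)}"]) fastforce
  next
    assume "\<exists>H\<subseteq>space \<Omega>. N = {x \<in> \<Pi>\<^sub>E A\<in>fin_ne_subsets {..<k}. space \<Omega>. x {..<k} \<in> H}"
    then obtain H where "N = {x \<in> \<Pi>\<^sub>E A\<in>fin_ne_subsets {..<k}. space \<Omega>. x {..<k} \<in> H}" by blast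
    then show "\<exists>Q. N = {x \<in> \<Pi>\<^sub>E A\<in>fin_ne_subsets {..<k}. space \<Omega>. Q (?r (x {..<k}))}"
      by (intro exI[of _ "\<lambda>h. h {..<k} \<in> H"]) simp
  qed
qed

lemma independent_peon_low_iff:
  assumes "m < k"
  shows "independent_peon \<Omega> m (k - 1) N \<longleftrightarrow>
    (\<exists>b. N = {x \<in> \<Pi>\<^sub>E A\<in>fin_ne_subsets {..<m}. space \<Omega>. b})"
  unfolding independent_peon_iff large_subsets_empty[OF assms] restrict_def empty_iff if_False
proof
  assume "\<exists>b. N = {x \<in> \<Pi>\<^sub>E A\<in>fin_ne_subsets {..<m}. space \<Omega>. b}"
  then obtain b where "N = {x \<in> \<Pi>\<^sub>E A\<in>fin_ne_subsets {..<m}. space \<Omega>. b}" by (elim exE)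
  then show "\<exists>Q. N = {x \<in> \<Pi>\<^sub>E A\<in>fin_ne_subsets {..<m}. space \<Omega>. Q (\<lambda>x. undefined)}"
    by (rule exI[of _ "\<lambda>_. b"])
qed (elim exE, rule exI)

lemma complete_section_measurable:
  assumes \<Omega>: "prob_space \<Omega>" "complete_measure \<Omega>" and i: "i \<in> I" and H: "H \<subseteq> space \<Omega>"
    and meas: "{x \<in> space (Pi\<^sub>M I (\<lambda>_. \<Omega>)). x i \<in> H} \<in> sets (completion (Pi\<^sub>M I (\<lambda>_. \<Omega>)))"
  shows "H \<in> sets \<Omega>"
proof -
  let ?P = "Pi\<^sub>M I (\<lambda>_. \<Omega>)" and ?P' = "Pi\<^sub>M (I - {i}) (\<lambda>_. \<Omega>)"
  interpret \<Omega>: prob_space \<Omega> by fact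
  interpret P': prob_space ?P' by (intro prob_space_PiM \<Omega>)
  interpret pair_sigma_finite \<Omega> ?P' ..
  interpret \<Omega>': complete_measure \<Omega> by fact
  have ins: "insert i (I - {i}) = I" using i by blast
  obtain S Z Z' where S: "{x \<in> space ?P. x i \<in> H} = S \<union> Z" "Z \<subseteq> Z'" "Z' \<in> null_sets ?P" "S \<in> sets ?P"
    using meas by (rule sets_completionE)
  have upd: "(\<lambda>(a, y). y(i := a)) \<in> measurable (\<Omega> \<Otimes>\<^sub>M ?P') ?P"
    using measurable_compose[OF measurable_pair_swap' measurable_add_dim[of i "I - {i}" "\<lambda>_. \<Omega>"]]
    unfolding ins by (simp add: case_prod_beta')
  have distr: "distr (\<Omega> \<Otimes>\<^sub>M ?P') ?P (\<lambda>(a, y). y(i := a)) = ?P"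
    using distr_pair_PiM_eq_PiM[of "I - {i}" "\<lambda>_. \<Omega>" i] \<Omega> unfolding ins by simp
  have "AE x in distr (\<Omega> \<Otimes>\<^sub>M ?P') ?P (\<lambda>(a, y). y(i := a)). x \<notin> Z'"
    unfolding distr using S(3) by (rule AE_not_in)
  then have "AE w in \<Omega> \<Otimes>\<^sub>M ?P'. (case w of (a, y) \<Rightarrow> y(i := a)) \<notin> Z'"
    by (rule AE_distrD[OF upd])
  then have "AE a in \<Omega>. AE y in ?P'. y(i := a) \<notin> Z'"
    using AE_pair by fastforce
  then have "AE y in ?P'. AE a in \<Omega>. y(i := a) \<notin> Z'"
  proof (rule AE_commute[THEN iffD1, rotated])
    have "(\<lambda>(a, y). y(i := a)) -` (space ?P - Z') \<inter> space (\<Omega> \<Otimes>\<^sub>M ?P') \<in> sets (\<Omega> \<Otimes>\<^sub>M ?P')"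
      using S(3) by (intro measurable_sets[OF upd]) auto
    also have "(\<lambda>(a, y). y(i := a)) -` (space ?P - Z') \<inter> space (\<Omega> \<Otimes>\<^sub>M ?P') =
        {x \<in> space (\<Omega> \<Otimes>\<^sub>M ?P'). (snd x)(i := fst x) \<notin> Z'}"
      using measurable_space[OF upd] by auto
    finally show "{x \<in> space (\<Omega> \<Otimes>\<^sub>M ?P'). (snd x)(i := fst x) \<notin> Z'} \<in> sets (\<Omega> \<Otimes>\<^sub>M ?P')" .
  qed
  then have ae: "AE y in ?P'. y \<in> space ?P' \<and> (AE a in \<Omega>. y(i := a) \<notin> Z')"
    using AE_space by eventually_elim blast
  have "\<exists>y. y \<in> space ?P' \<and> (AE a in \<Omega>. y(i := a) \<notin> Z')"
  proof (rule ccontr)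
    assume "\<not> ?thesis"
    then have "AE y in ?P'. False" using ae by (elim eventually_mono) blast
    then show False by simp
  qed
  then obtain y where y: "y \<in> space ?P'" "AE a in \<Omega>. y(i := a) \<notin> Z'" by blast
  have sec: "(\<lambda>a. y(i := a)) \<in> measurable \<Omega> ?P"
    using measurable_compose[OF measurable_Pair2'[OF y(1)] upd] unfolding prod.case .
  have "AE a in \<Omega>. a \<in> (\<lambda>a. y(i := a)) -` S \<inter> space \<Omega> \<longleftrightarrow> a \<in> H"
    using y(2) AE_space
  proof eventually_elim
    case (elim a)
    then have "y(i := a) \<in> space ?P" using measurable_space[OF sec] by blast
    then have "y(i := a) \<in> S \<union> Z \<longleftrightarrow> a \<in> H" unfolding S(1)[symmetric] by simp
    then show ?case using elim S(2) by auto
  qed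
  then show "H \<in> sets \<Omega>"
    using measurable_sets[OF sec S(4)] H by (rule \<Omega>'.in_sets_AE)
qed

lemma canonical_model_distinct:
  assumes L: "is_language L" and T: "canonical_theory L T" and K: "is_model L T K"
    and P: "P \<in> preds L" and xs: "xs \<in> rel K P"
  shows "distinct xs"
proof -
  have "set xs \<subseteq> verts K \<and> length xs = arity L P"
    using K P xs by (auto simp: is_model_def is_structure_def)
  then obtain s where s: "range s \<subseteq> verts K" "map s [0..<arity L P] = xs"
    using ex_assignment L P by (metis is_language_def)
  then have "sat K s (diag_axiom L P)" using K T P by (auto simp: is_model_def canonical_theory_def)
  then show ?thesis using s(2) xs by (auto simp: diag_axiom_def)
qed

lemma pullback_in_space:
  assumes "\<theta> \<in> space (E_space UNIV \<Omega>)"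
  shows "pullback {..<m} ((!) xs) \<theta> \<in> (\<Pi>\<^sub>E A\<in>fin_ne_subsets {..<m}. space \<Omega>)"
  unfolding pullback_def restrict_PiE_iff
proof
  fix A assume "A \<in> fin_ne_subsets {..<m}"
  then have "(!) xs ` A \<in> fin_ne_subsets UNIV" by (simp add: fin_ne_subsets_def)
  then show "\<theta> ((!) xs ` A) \<in> space \<Omega>" by (rule PiE_mem[OF assms[unfolded space_E_space]])
qed

lemma pullback_top:
  assumes "1 \<le> k" "length xs = k"
  shows "pullback {..<k} ((!) xs) \<theta> {..<k} = \<theta> (set xs)"
proof -
  have "{..<k} \<in> fin_ne_subsets {..<k}" using large_subsets_eq[OF assms(1)] by blast
  moreover have "(!) xs ` {..<k} = set xs" using assms(2) by (auto simp: set_conv_nth)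
  ultimately show ?thesis by (simp add: pullback_def)
qed

theorem independence_interp_limit:
  fixes \<Omega> :: "'x measure"
  assumes k: "1 \<le> k" and L: "is_language L" and ar: "\<forall>P\<in>preds L. arity L P \<le> k"
    and T: "canonical_theory L T" and \<Omega>: "atomless_complete_prob_space \<Omega>"
    and p: "p \<in> prob_simplex c"
    and I: "open_interpretation L T (col_language c k) (col_theory c k) I"
  shows "independence TYPE('x) L T (k - 1)
    (interp_limit L T (col_language c k) (col_theory c k) I (quasirandom_limit c k p))"
proof -
  have prob: "prob_space \<Omega>" "atomless \<Omega>" using \<Omega> by (auto simp: atomless_complete_prob_space_def)
  obtain g where g: "g \<in> measurable \<Omega> (count_space UNIV)" "\<And>x. g x \<in> {1..c}"
    and gp: "\<And>i. i \<in> {1..c} \<Longrightarrow> measure \<Omega> {x \<in> space \<Omega>. g x = i} = p i"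
    using atomless_finite_distribution[OF prob p] by blast
  define val where "val P i = sat (colouring_struct k UNIV (\<lambda>_. i)) (\<lambda>j::nat. j) (I P)" for P i
  define N where "N P = {x \<in> \<Pi>\<^sub>E A\<in>fin_ne_subsets {..<arity L P}. space \<Omega>.
      val P (if arity L P = k then g (x {..<k}) else 1)}" for P
  have Iwf: "wf_qf (col_language c k) (I P)" "fvars (I P) \<subseteq> {..<arity L P}" if "P \<in> preds L" for P
    using I that by (auto simp: open_interpretation_def)
  let ?K = "\<lambda>\<theta>. colouring_struct k UNIV (\<lambda>A. g (\<theta> A)) :: (nat, nat) rstruct"
  have model: "is_model L T (interp L I (?K \<theta>))" for \<theta>
    using open_interpretation_all_models[OF I is_model_colouring_struct[OF k g(2)]] .
  have eq: "theon_struct L N \<theta> = interp L I (?K \<theta>)" if \<theta>: "\<theta> \<in> space (E_space UNIV \<Omega>)" for \<theta>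
  proof -
    have "xs \<in> rel (theon_struct L N \<theta>) P \<longleftrightarrow> xs \<in> rel (interp L I (?K \<theta>)) P" for P xs
    proof (cases "P \<in> preds L \<and> length xs = arity L P \<and> distinct xs")
      case True
      then have P: "P \<in> preds L" and xs: "length xs = arity L P" "distinct xs" by auto
      have "xs \<in> rel (theon_struct L N \<theta>) P \<longleftrightarrow>
          val P (if length xs = k then g (\<theta> (set xs)) else 1)"
        using P xs pullback_in_space[OF \<theta>] pullback_top[OF k, of xs \<theta>]
        by (auto simp: theon_struct_def N_def)
      also have "\<dots> \<longleftrightarrow> sat (?K \<theta>) ((!) xs) (I P)"
        unfolding val_def using xs Iwf[OF P] ar P
        by (intro sat_colouring_struct_monochromatic[symmetric]) auto
      also have "\<dots> \<longleftrightarrow> xs \<in> rel (interp L I (?K \<theta>)) P"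
        using P xs by (simp add: interp_def)
      finally show ?thesis .
    next
      case False
      then have "xs \<notin> rel (theon_struct L N \<theta>) P" by (auto simp: theon_struct_def)
      moreover have "xs \<notin> rel (interp L I (?K \<theta>)) P"
        using False canonical_model_distinct[OF L T model, of P xs \<theta>] by (auto simp: interp_def)
      ultimately show ?thesis by simp
    qed
    then have "rel (theon_struct L N \<theta>) = rel (interp L I (?K \<theta>))" by blast
    then show ?thesis by (simp add: theon_struct_def interp_def)
  qed
  have "N P \<in> sets (E_space {..<arity L P} \<Omega>)" if "P \<in> preds L" for P
  proof -
    let ?P = "Pi\<^sub>M (fin_ne_subsets {..<arity L P}) (\<lambda>_. \<Omega>)"
    have "(\<lambda>x. if arity L P = k then g (x {..<k}) else 1) \<in> measurable ?P (count_space UNIV)"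
    proof (cases "arity L P = k")
      case True
      have "{..<k} \<in> fin_ne_subsets {..<arity L P}" using large_subsets_eq[OF k] True by blast
      from measurable_compose[OF measurable_component_singleton[OF this] g(1)]
      show ?thesis using True by simp
    qed simp
    then have "(\<lambda>x. if arity L P = k then g (x {..<k}) else 1) -` {i. val P i} \<inter> space ?P \<in> sets ?P"
      by (rule measurable_sets) simp
    also have "(\<lambda>x. if arity L P = k then g (x {..<k}) else 1) -` {i. val P i} \<inter> space ?P = N P"
      by (auto simp: N_def space_PiM)
    finally show ?thesis by (simp add: E_space_def)
  qed
  moreover have "AE \<theta> in E_space UNIV \<Omega>. is_model L T (theon_struct L N \<theta>)"
    using AE_space by eventually_elim (simp add: eq model)
  ultimately have "is_theon \<Omega> L T N" by (simp add: is_theon_def)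
  moreover have "independent_peon \<Omega> (arity L P) (k - 1) (N P)" if P: "P \<in> preds L" for P
  proof (cases "arity L P = k")
    case True
    have "{..<k} \<in> fin_ne_subsets {..<k}" using large_subsets_eq[OF k] by blast
    then have "N P = {x \<in> \<Pi>\<^sub>E A\<in>fin_ne_subsets {..<k}. space \<Omega>. x {..<k} \<in> {a \<in> space \<Omega>. val P (g a)}}"
      unfolding N_def True by (auto dest: PiE_mem)
    then show ?thesis
      unfolding True independent_peon_top_iff[OF k] by blast
  next
    case False
    then have "arity L P < k" using ar P by (simp add: le_neq_implies_less)
    then show ?thesis unfolding independent_peon_low_iff[OF \<open>arity L P < k\<close>] N_def by auto
  qed
  moreover have "theon_limit \<Omega> L T N =
      interp_limit L T (col_language c k) (col_theory c k) I (quasirandom_limit c k p)"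
    using AE_space eq by (intro theon_limit_colouring[OF k prob(1) g gp I]) (auto elim: eventually_mono)
  ultimately show ?thesis using \<Omega> unfolding independence_def by metis
qed

section \<open>Theons with independent peons\<close>

lemma finite_fvars: "finite (fvars F)"
  by (induction F) auto

lemma fvars_BigOrF: "fvars (BigOrF Fs) = insert 0 (\<Union>F\<in>set Fs. fvars F)"
  unfolding BigOrF_def by (induction Fs) (auto simp: OrF_def)

lemma fvars_coincF: "1 \<le> k \<Longrightarrow> fvars (coincF k) \<subseteq> {..<k}"
  by (auto simp: coincF_def fvars_BigOrF)

text \<open>Every finite coloured hypergraph occurs in the random one with positive probability, so an
  axiom of \<open>T\<close> failing in some \<open>interp L I K\<close> would fail in the theon with positive probability.\<close>

lemma open_interpretation_if_theon:
  fixes I :: "'p \<Rightarrow> nat qf"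
  assumes k: "1 \<le> k" and \<Omega>: "prob_space \<Omega>"
    and g: "g \<in> measurable \<Omega> (count_space UNIV)"
    and pos: "\<And>i. i \<in> {1..c} \<Longrightarrow> 0 < measure \<Omega> {x \<in> space \<Omega>. g x = i}"
    and I: "\<And>P. P \<in> preds L \<Longrightarrow> wf_qf (col_language c k) (I P) \<and> fvars (I P) \<subseteq> {..<arity L P}"
    and N: "is_theon \<Omega> L T N"
    and ae: "AE \<theta> in E_space UNIV \<Omega>. theon_struct L N \<theta> = interp L I (colouring_struct k UNIV (\<lambda>A. g (\<theta> A)))"
  shows "open_interpretation L T (col_language c k) (col_theory c k) I"
  unfolding open_interpretation_def
proof (intro conjI ballI allI impI)
  fix K :: "(nat, nat) rstruct" assume "is_model (col_language c k) (col_theory c k) K"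
  then obtain f where f: "f \<in> ksubsets k (verts K) \<rightarrow>\<^sub>E {1..c}" "K = colouring_struct k (verts K) f"
    using model_col_theory_obtain[OF k] by blast
  have "sat (interp L I K) s F" if F: "F \<in> T" and s: "range s \<subseteq> verts K" for F s
  proof -
    define W where "W = s ` fvars F"
    have W: "finite W" "W \<subseteq> verts K" using s finite_fvars by (auto simp: W_def)
    interpret E: prob_space "E_space UNIV \<Omega>" using \<Omega> by (rule prob_space_E_space)
    let ?Z = "{\<theta> \<in> space (E_space UNIV \<Omega>). \<forall>A\<in>ksubsets k W. g (\<theta> A) = f A}"
    note Z = E_space_cylinder[OF \<Omega> finite_ksubsets[OF W(1)] ksubsets_subset_fin_ne[OF k subset_UNIV] g,
        where f=f]
    have "f A \<in> {1..c}" if "A \<in> ksubsets k W" for A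
      using W(2) that by (intro PiE_mem[OF f(1)]) (auto simp: ksubsets_def)
    then have "0 < measure (E_space UNIV \<Omega>) ?Z"
      unfolding Z(2) by (intro prod_pos pos ballI)
    have "\<exists>\<theta>\<in>?Z. theon_struct L N \<theta> = interp L I (colouring_struct k UNIV (\<lambda>A. g (\<theta> A))) \<and>
        is_model L T (theon_struct L N \<theta>)"
    proof (rule ccontr)
      assume no: "\<not> ?thesis"
      have "AE \<theta> in E_space UNIV \<Omega>. is_model L T (theon_struct L N \<theta>)"
        using N by (simp add: is_theon_def)
      then have "AE \<theta> in E_space UNIV \<Omega>. \<theta> \<notin> ?Z" using ae by eventually_elim (use no in blast)
      then have "measure (E_space UNIV \<Omega>) ?Z = 0" using Z(1) by (subst (asm) E.prob_eq_0[symmetric]) auto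
      then show False using \<open>0 < measure (E_space UNIV \<Omega>) ?Z\<close> by simp
    qed
    then obtain \<theta> where \<theta>: "\<theta> \<in> ?Z" "is_model L T (theon_struct L N \<theta>)"
      and eq: "theon_struct L N \<theta> = interp L I (colouring_struct k UNIV (\<lambda>A. g (\<theta> A)))" by blast
    have Ifv: "\<And>P. P \<in> preds L \<Longrightarrow> fvars (I P) \<subseteq> {..<arity L P}" using I by blast
    have "sat (theon_struct L N \<theta>) s F"
      using \<theta>(2) F by (auto simp: is_model_def theon_struct_def)
    then have "sat (induced (theon_struct L N \<theta>) W) s F" by (simp add: sat_induced W_def)
    also have "induced (theon_struct L N \<theta>) W = interp L I (colouring_struct k W (\<lambda>A. g (\<theta> A)))"
      unfolding eq by (simp add: induced_interp[OF Ifv] induced_colouring_struct)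
    also have "colouring_struct k W (\<lambda>A. g (\<theta> A)) = induced (colouring_struct k (verts K) f) W"
      using \<theta>(1) W(2) by (simp add: induced_colouring_struct cong: colouring_struct_cong)
    also have "\<dots> = induced K W" using f(2) by simp
    also have "interp L I \<dots> = induced (interp L I K) W"
      using induced_interp[OF Ifv W(2)] by simp
    finally show ?thesis by (simp add: sat_induced W_def)
  qed
  then show "is_model L T (interp L I K)"
    unfolding is_model_def by (auto simp: is_structure_def interp_def)
qed (use I in auto)

lemma finite_range_colouring:
  fixes v :: "'x \<Rightarrow> 'w"
  assumes M: "prob_space M" and V: "finite V" "\<And>x. v x \<in> V"
    and v: "\<And>w. w \<in> V \<Longrightarrow> {x \<in> space M. v x = w} \<in> sets M"
      "\<And>w. w \<in> V \<Longrightarrow> measure M {x \<in> space M. v x = w} < 1"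
  obtains c g p and e :: "nat \<Rightarrow> 'w" where "1 \<le> c" "g \<in> measurable M (count_space UNIV)"
    "\<And>x. g x \<in> {1..c}" "p \<in> prob_simplex c"
    "\<And>i. i \<in> {1..c} \<Longrightarrow> measure M {x \<in> space M. g x = i} = p i"
    "AE x in M. e (g x) = v x"
proof -
  interpret prob_space M by fact
  define W where "W = {w \<in> V. 0 < prob {x \<in> space M. v x = w}}"
  have finW: "finite W" using V(1) by (simp add: W_def)
  have aeW: "AE x in M. v x \<in> W"
  proof -
    have "AE x in M. v x \<noteq> w" if "w \<in> V - W" for w
    proof -
      have "prob {x \<in> space M. v x = w} = 0"
        using that measure_nonneg[of M "{x \<in> space M. v x = w}"] by (auto simp: W_def)
      then show ?thesis
        using v(1) that by (subst AE_iff_measurable[OF _ refl]) (auto simp: emeasure_eq_measure)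
    qed
    then have "AE x in M. \<forall>w\<in>V - W. v x \<noteq> w" using V(1) by (intro AE_finite_allI) auto
    then show ?thesis by eventually_elim (use V(2) in blast)
  qed
  have "W \<noteq> {}"
  proof
    assume "W = {}"
    then have "AE x in M. False" using aeW by simp
    then show False by simp
  qed
  define c where "c = card W"
  have c: "1 \<le> c" using finW \<open>W \<noteq> {}\<close> by (simp add: c_def Suc_leI card_gt_0_iff)
  obtain h where h: "bij_betw h {1..c} W" using ex_bij_betw_nat_finite_1[OF finW] c_def by blast
  let ?h' = "inv_into {1..c} h"
  define g where "g x = (if v x \<in> W then ?h' (v x) else 1)" for x
  define p where "p = (\<lambda>i\<in>{1..c}. prob {x \<in> space M. g x = i})"
  have "v \<in> measurable M (count_space V)"
    unfolding measurable_count_space_eq2[OF V(1)] using V(2) v(1) by (auto simp: vimage_def Int_def conj_commute)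
  moreover have "(\<lambda>w. if w \<in> W then ?h' w else 1) \<in> measurable (count_space V) (count_space UNIV)" by simp
  ultimately have meas: "g \<in> measurable M (count_space UNIV)"
    unfolding g_def by (rule measurable_compose)
  have h': "?h' w \<in> {1..c}" "h (?h' w) = w" if "w \<in> W" for w
    using h that by (auto simp: bij_betw_def inv_into_into f_inv_into_f)
  have range: "g x \<in> {1..c}" for x using h'(1) c by (auto simp: g_def)
  have p_eq: "prob {x \<in> space M. g x = i} = prob {x \<in> space M. v x = h i}" if i: "i \<in> {1..c}" for i
  proof (rule finite_measure_eq_AE)
    have "?h' (h i) = i" using h i by (simp add: bij_betw_def)
    then have gi: "g x = i \<longleftrightarrow> v x = h i" if "v x \<in> W" for x using that h'(2) by (auto simp: g_def)
    show "AE x in M. x \<in> {x \<in> space M. g x = i} \<longleftrightarrow> x \<in> {x \<in> space M. v x = h i}"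
      using aeW by eventually_elim (simp add: gi)
    have "h i \<in> V" using h i by (auto simp: bij_betw_def W_def)
    then show "{x \<in> space M. v x = h i} \<in> events" by (rule v(1))
    show "{x \<in> space M. g x = i} \<in> events" using meas by measurable
  qed
  have "0 < p i \<and> p i < 1" if "i \<in> {1..c}" for i
  proof -
    have "h i \<in> W" using h that by (auto simp: bij_betw_def)
    then show ?thesis using p_eq[OF that] v(2) that by (simp add: p_def W_def)
  qed
  moreover have "(\<Sum>i=1..c. p i) = prob (\<Union>i\<in>{1..c}. {x \<in> space M. g x = i})"
    unfolding p_def using meas
    by (subst finite_measure_finite_Union) (auto simp: disjoint_family_on_def)
  moreover have "(\<Union>i\<in>{1..c}. {x \<in> space M. g x = i}) = space M" using range by auto
  ultimately have "p \<in> prob_simplex c"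
    by (auto simp: prob_simplex_def prob_space p_def)
  moreover have "AE x in M. h (g x) = v x"
    using aeW by eventually_elim (use h'(2) in \<open>simp add: g_def\<close>)
  ultimately show ?thesis using that[OF c meas range] by (simp add: p_def)
qed

theorem independence_imp_interp_limit:
  assumes k: "1 \<le> k" and L: "is_language L" and ar: "\<forall>P\<in>preds L. arity L P \<le> k"
    and ind: "independence TYPE('x) L T (k - 1) \<phi>"
  shows "\<exists>c \<ge> 1. \<exists>p \<in> prob_simplex c. \<exists>I.
    open_interpretation L T (col_language c k) (col_theory c k) I \<and>
    \<phi> = interp_limit L T (col_language c k) (col_theory c k) I (quasirandom_limit c k p)"
proof -
  obtain \<Omega> :: "'x measure" and N where \<Omega>: "atomless_complete_prob_space \<Omega>" and N: "is_theon \<Omega> L T N"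
    and peon: "\<And>P. P \<in> preds L \<Longrightarrow> independent_peon \<Omega> (arity L P) (k - 1) (N P)"
    and \<phi>: "\<phi> = theon_limit \<Omega> L T N"
    using ind unfolding independence_def by blast
  have prob: "prob_space \<Omega>" and compl: "complete_measure \<Omega>" and atl: "atomless \<Omega>"
    using \<Omega> by (auto simp: atomless_complete_prob_space_def)
  interpret \<Omega>: prob_space \<Omega> by fact
  have "\<forall>P\<in>preds L. \<exists>H. arity L P = k \<longrightarrow> H \<subseteq> space \<Omega> \<and>
      N P = {x \<in> \<Pi>\<^sub>E A\<in>fin_ne_subsets {..<k}. space \<Omega>. x {..<k} \<in> H}"
  proof
    fix P assume P: "P \<in> preds L"
    show "\<exists>H. arity L P = k \<longrightarrow> H \<subseteq> space \<Omega> \<and>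
        N P = {x \<in> \<Pi>\<^sub>E A\<in>fin_ne_subsets {..<k}. space \<Omega>. x {..<k} \<in> H}"
      using peon[OF P] independent_peon_top_iff[OF k, of \<Omega> "N P"] by (cases "arity L P = k") auto
  qed
  from bchoice[OF this] obtain H where H: "\<And>P. P \<in> preds L \<Longrightarrow> arity L P = k \<Longrightarrow> H P \<subseteq> space \<Omega>"
    "\<And>P. P \<in> preds L \<Longrightarrow> arity L P = k \<Longrightarrow>
      N P = {x \<in> \<Pi>\<^sub>E A\<in>fin_ne_subsets {..<k}. space \<Omega>. x {..<k} \<in> H P}"
    by blast
  have "\<forall>P\<in>preds L. \<exists>b. arity L P < k \<longrightarrow>
      N P = {x \<in> \<Pi>\<^sub>E A\<in>fin_ne_subsets {..<arity L P}. space \<Omega>. b}"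
  proof
    fix P assume P: "P \<in> preds L"
    show "\<exists>b. arity L P < k \<longrightarrow>
        N P = {x \<in> \<Pi>\<^sub>E A\<in>fin_ne_subsets {..<arity L P}. space \<Omega>. b}"
      using peon[OF P] independent_peon_low_iff[of "arity L P" k \<Omega> "N P"]
      by (cases "arity L P < k") simp_all
  qed
  from bchoice[OF this] obtain b where "\<forall>P\<in>preds L. arity L P < k \<longrightarrow>
      N P = {x \<in> \<Pi>\<^sub>E A\<in>fin_ne_subsets {..<arity L P}. space \<Omega>. b P}"
    by (elim exE)
  note b = this[rule_format]
  define Pk where "Pk = {P \<in> preds L. arity L P = k}"
  have finPk: "finite Pk" using L by (simp add: Pk_def is_language_def)
  have Hsets: "H P \<in> sets \<Omega>" if "P \<in> Pk" for P
  proof (rule complete_section_measurable[OF prob compl])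
    show "{..<k} \<in> fin_ne_subsets {..<k}" using large_subsets_eq[OF k] by blast
    show "H P \<subseteq> space \<Omega>" using H(1) that by (simp add: Pk_def)
    have "N P \<in> sets (E_space {..<k} \<Omega>)" using N that by (auto simp: is_theon_def Pk_def)
    then show "{x \<in> space (Pi\<^sub>M (fin_ne_subsets {..<k}) (\<lambda>_. \<Omega>)). x {..<k} \<in> H P}
        \<in> sets (completion (Pi\<^sub>M (fin_ne_subsets {..<k}) (\<lambda>_. \<Omega>)))"
      using H(2) that by (simp add: E_space_def space_PiM Pk_def)
  qed
  obtain B where B: "B \<in> sets \<Omega>" "measure \<Omega> B = 1 / 2"
    using atomless_intermediate_measure[OF \<Omega>.finite_measure_axioms atl sets.top, of "1/2"]
    by (auto simp: \<Omega>.prob_space)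
  \<comment> \<open>Splitting every class along \<open>B\<close> keeps all colour probabilities below 1, which matters when
    only one set of predicates has positive probability.\<close>
  define v where "v x = ({P \<in> Pk. x \<in> H P}, x \<in> B)" for x
  have v_sets: "{x \<in> space \<Omega>. v x = w} \<in> sets \<Omega>" if "w \<in> Pow Pk \<times> UNIV" for w
  proof -
    have "{x \<in> space \<Omega>. v x = w} =
        {x \<in> space \<Omega>. (\<forall>P\<in>Pk. x \<in> H P \<longleftrightarrow> P \<in> fst w) \<and> (x \<in> B \<longleftrightarrow> snd w)}"
      using that by (auto simp: v_def prod_eq_iff)
    also have "\<dots> \<in> sets \<Omega>"
      using Hsets B(1) finPk by (intro sets.sets_Collect) auto
    finally show ?thesis .
  qed
  have v_less: "measure \<Omega> {x \<in> space \<Omega>. v x = w} < 1" if "w \<in> Pow Pk \<times> UNIV" for w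
  proof -
    have "{x \<in> space \<Omega>. v x = w} \<subseteq> (if snd w then B else space \<Omega> - B)" by (auto simp: v_def)
    then have "measure \<Omega> {x \<in> space \<Omega>. v x = w} \<le> measure \<Omega> (if snd w then B else space \<Omega> - B)"
      using B(1) by (intro \<Omega>.finite_measure_mono) auto
    also have "\<dots> = 1 / 2" using B \<Omega>.prob_compl[OF B(1)] by simp
    finally show ?thesis by simp
  qed
  have vV: "v x \<in> Pow Pk \<times> UNIV" for x by (auto simp: v_def)
  have finV: "finite (Pow Pk \<times> (UNIV :: bool set))" using finPk by simp
  obtain c g p e where c: "1 \<le> c" and g: "g \<in> measurable \<Omega> (count_space UNIV)" "\<And>x. g x \<in> {1..c}"
    and p: "p \<in> prob_simplex c" and gp: "\<And>i. i \<in> {1..c} \<Longrightarrow> measure \<Omega> {x \<in> space \<Omega>. g x = i} = p i"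
    and e: "AE x in \<Omega>. e (g x) = v x"
    using finite_range_colouring[OF prob finV vV v_sets v_less] by blast
  define I where "I P =
    (if arity L P = k then BigOrF (map (\<lambda>i. RelF i [0..<k]) (filter (\<lambda>i. P \<in> fst (e i)) [1..<Suc c]))
     else if b P then NegF (coincF (arity L P)) else NegF (EqF 0 0))" for P
  have Iwf: "wf_qf (col_language c k) (I P) \<and> fvars (I P) \<subseteq> {..<arity L P}" if "P \<in> preds L" for P
  proof -
    have "1 \<le> arity L P" using L that by (simp add: is_language_def)
    then show ?thesis using k fvars_coincF by (auto simp: I_def fvars_BigOrF col_language_def)
  qed
  let ?K = "\<lambda>\<theta>. colouring_struct k UNIV (\<lambda>A. g (\<theta> A)) :: (nat, nat) rstruct"
  have "countable (fin_ne_subsets (UNIV :: nat set))"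
    by (rule countable_subset[OF _ countable_Collect_finite]) (auto simp: fin_ne_subsets_def)
  moreover have "AE \<theta> in Pi\<^sub>M (fin_ne_subsets UNIV) (\<lambda>_. \<Omega>). e (g (\<theta> A)) = v (\<theta> A)"
    if "A \<in> fin_ne_subsets UNIV" for A :: "nat set"
    by (rule AE_PiM_component[OF prob that e])
  ultimately have "AE \<theta> in E_space UNIV \<Omega>. \<forall>A\<in>fin_ne_subsets (UNIV :: nat set). e (g (\<theta> A)) = v (\<theta> A)"
    unfolding E_space_def by (intro AE_completion) (simp add: AE_ball_countable)
  then have ae: "AE \<theta> in E_space UNIV \<Omega>. theon_struct L N \<theta> = interp L I (?K \<theta>)"
    using AE_space
  proof eventually_elim
    case (elim \<theta>)
    have "xs \<in> rel (theon_struct L N \<theta>) P \<longleftrightarrow> xs \<in> rel (interp L I (?K \<theta>)) P" for P xs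
    proof (cases "P \<in> preds L \<and> length xs = arity L P")
      case True
      then have P: "P \<in> preds L" and xs: "length xs = arity L P" by auto
      show ?thesis
      proof (cases "arity L P = k")
        case k': True
        have "set xs \<in> fin_ne_subsets UNIV" using xs k' k by (auto simp: fin_ne_subsets_def)
        then have "e (g (\<theta> (set xs))) = v (\<theta> (set xs))" using elim by blast
        then have "P \<in> fst (e (g (\<theta> (set xs)))) \<longleftrightarrow> \<theta> (set xs) \<in> H P"
          using P k' by (simp add: v_def Pk_def)
        moreover have "xs \<in> rel (theon_struct L N \<theta>) P \<longleftrightarrow> distinct xs \<and> \<theta> (set xs) \<in> H P"
          using P xs k' pullback_in_space[OF elim(2), of k xs] pullback_top[OF k, of xs \<theta>]
          by (simp add: theon_struct_def H(2))
        moreover have "sat (?K \<theta>) ((!) xs) (RelF i [0..<k]) \<longleftrightarrow> distinct xs \<and> g (\<theta> (set xs)) = i" for i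
        proof -
          have "map ((!) xs) [0..<k] = xs" using xs k' map_nth[of xs] by simp
          then show ?thesis unfolding sat.simps using xs k' by (auto simp: colouring_struct_def)
        qed
        then have "xs \<in> rel (interp L I (?K \<theta>)) P \<longleftrightarrow> distinct xs \<and> P \<in> fst (e (g (\<theta> (set xs))))"
          using P xs k' g(2)[of "\<theta> (set xs)"]
          by (auto simp: interp_def I_def less_Suc_eq_le simp del: upt_Suc sat.simps(2))
        ultimately show ?thesis by simp
      next
        case False
        then have "arity L P < k" using ar P by (simp add: le_neq_implies_less)
        then have "xs \<in> rel (theon_struct L N \<theta>) P \<longleftrightarrow> distinct xs \<and> b P"
          using P xs pullback_in_space[OF elim(2), of "arity L P" xs] by (simp add: theon_struct_def b)
        moreover have "map ((!) xs) [0..<arity L P] = xs" using xs map_nth[of xs] by simp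
        then have "xs \<in> rel (interp L I (?K \<theta>)) P \<longleftrightarrow> distinct xs \<and> b P"
          using P xs False by (simp add: interp_def I_def del: distinct_map)
        ultimately show ?thesis by simp
      qed
    qed (auto simp: theon_struct_def interp_def)
    then have "rel (theon_struct L N \<theta>) = rel (interp L I (?K \<theta>))" by blast
    then show ?case by (simp add: theon_struct_def interp_def)
  qed
  have "0 < measure \<Omega> {x \<in> space \<Omega>. g x = i}" if "i \<in> {1..c}" for i
    using gp[OF that] p that by (auto simp: prob_simplex_def PiE_def Pi_iff)
  then have I: "open_interpretation L T (col_language c k) (col_theory c k) I"
    using open_interpretation_if_theon[OF k prob g(1) _ Iwf N ae] by blast
  moreover have "\<phi> = interp_limit L T (col_language c k) (col_theory c k) I (quasirandom_limit c k p)"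
    unfolding \<phi> by (rule theon_limit_colouring[OF k prob g gp I ae])
  ultimately show ?thesis using c p by blast
qed

theorem theorem3p12:
  fixes k :: nat
    and L :: "'p language"
    and T :: "'p qf set"
    and \<phi> :: "'p iclass \<Rightarrow> real"
  assumes "1 \<le> k"
    and "is_language L"
    and "\<forall>P\<in>preds L. arity L P \<le> k"
    and "canonical_theory L T"
    and "\<phi> \<in> Hom_plus L T"
    and "\<exists>\<Omega> :: 'x measure. atomless_complete_prob_space \<Omega>"
  shows "independence TYPE('x) L T (k - 1) \<phi> \<longleftrightarrow>
    (\<exists>c \<ge> 1. \<exists>p \<in> prob_simplex c. \<exists>I.
       open_interpretation L T (col_language c k) (col_theory c k) I \<and>
       \<phi> = interp_limit L T (col_language c k) (col_theory c k) I (quasirandom_limit c k p))"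
  using independence_imp_interp_limit[OF assms(1-3)] independence_interp_limit[OF assms(1-4)] assms(6)
  by blast

end
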